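(* Let $K(n,k,l)$ (for integers $n,k,l\ge0$ with $2k+l\le n$ and $2k+l\equiv n \bmod 2$) be the recursively defined array of integers given in the context. Suppose that $$\frac{K(n-2,k,l)}{K(n,k,l)}\ \ge\ \max\left(\frac{K(n-2,k+1,l)}{K(n,k+1,l)},\ \frac{K(n-2,k,l+2)}{K(n,k,l+2)}\right)$$ for all $n\ge3$ and all $k,l\ge0$ such that $2k+l<n-2$ and $2k+l\equiv n\bmod 2$, so that in particular $$\max_{2k+l<n,\ 2k+l\equiv n \bmod 2}\frac{K(n-2,k,l)}{K(n,k,l)}=\frac{K(n-2,0,\delta(n))}{K(n,0,\delta(n))},$$ where $\delta(n)=0$ if $n$ is even and $\delta(n)=1$ if $n$ is odd. Then any central measure on the path space of the pascalization $\mathcal{P}(\Theta)$ of the coupled Young graph $\Theta$ is fully supported on $\Theta\subset\mathcal{P}(\Theta)$ (and thus on the Young graph $\mathbb{Y}\subset\Theta$).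
   Context: The array $K$. $K(0,0,0)=1$; $K(n,k,l)=\frac{1}{2^k}\frac{(2k+l)!}{k!\,l!}$ whenever $2k+l=n$; and for $n\ge1$ and all $k,l\ge0$ with $2k+l<n$, $2k+l\equiv n\bmod2$, $$K(n,k,l)=K(n-1,k,l-1)+(l+1)\big(K(n-1,k,l+1)+K(n-1,k-1,l+1)\big)+(k+1)K(n-1,k+1,l-1),$$ where terms with a negative index are $0$. Graphs. $\mathbb{Y}_k$ is the set of Young diagrams with $k$ boxes, $\mathbb{Y}_0=\{\emptyset\}$; $\lambda\pm\Box$ denotes a diagram obtained by adding/removing one box. The coupled Young graph $\Theta$ is the graded graph with $\Theta_n=\bigsqcup_{k=0}^{\lfloor n/2\rfloor}\mathbb{Y}_k\times\mathbb{Y}_{n-2k}$ and one edge between $(\lambda,\mu)\in\Theta_n$ and $(\lambda',\mu')\in\Theta_{n+1}$ iff either $\lambda'=\lambda$, $\mu'=\mu+\Box$, or $\lambda'=\lambda+\Box$, $\mu'=\mu-\Box$. The Young graph $\mathbb{Y}$ (levels $\mathbb{Y}_n$, edges $\mu\nearrow\mu+\Box$) is the subgraph of $\Theta$ on the vertices $(\emptyset,\mu)$. The pascalization $\mathcal{P}(\Gamma)$ of a graded graph $\Gamma$ has level-$n$ vertices $(n,\gamma)$ with $\gamma\in\Gamma_k$, $k\le n$, $k\equiv n\bmod 2$; the number of edges between $(n,\gamma)$ and $(n+1,\tilde\gamma)$ is the number of undirected edges between $\gamma$ and $\tilde\gamma$ in $\Gamma$. $\Gamma$ is viewed as the subgraph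 of $\mathcal{P}(\Gamma)$ on the vertices $(n,\gamma)$ with $\gamma\in\Gamma_n$. The graph $\mathcal{P}(\Theta)$ is the branching graph of the infinite diagram algebra $A_{(\mathcal{H},\delta)}(\infty)$ (partitions with even block sizes) at generic loop parameter. Central measures. For a graded graph $\Gamma$ with root, $\gamma\nearrow\tilde\gamma$ means that vertices of consecutive levels are joined by an edge; $\dim_\Gamma(\gamma)$ is the number of level-increasing paths from the root to $\gamma$; $\Omega_\Gamma$ is the space of infinite paths from the root with the $\sigma$-algebra induced by the product. A probability measure $\mathbb{P}$ on $\Omega_\Gamma$ is central if $\mathbb{P}(\omega_1=\gamma_1,\dots,\omega_n=\gamma)=\mathbb{P}(\omega_n=\gamma)/\dim_\Gamma(\gamma)$ for every path $\gamma_0\nearrow\cdots\nearrow\gamma_n=\gamma$ from the root. It is fully supported on a subgraph if it gives measure $1$ to the set of paths that stay in the subgraph. *)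

theory Defs
  imports "HOL-Probability.Probability"
begin

text \<open>
  The array \<open>K\<close>.  Entries outside the index range \<open>2k + l \<le> n\<close>, \<open>2k + l \<equiv> n (mod 2)\<close> are set to 0;
  the recursion never refers to them, except for the terms with a negative index, which are 0
  by convention (here: the guards \<open>k = 0\<close>, \<open>l = 0\<close>, since subtraction on \<^typ>\<open>nat\<close> truncates).
\<close>

primrec K :: "nat \<Rightarrow> nat \<Rightarrow> nat \<Rightarrow> real" where
  "K 0 k l = (if k = 0 \<and> l = 0 then 1 else 0)"
| "K (Suc n) k l =
    (if 2 * k + l = Suc n then 1 / 2 ^ k * (fact (2 * k + l) / (fact k * fact l))
     else if 2 * k + l < Suc n \<and> (2 * k + l) mod 2 = Suc n mod 2 then
       (if l = 0 then 0 else K n k (l - 1))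
       + (real l + 1) * (K n k (l + 1) + (if k = 0 then 0 else K n (k - 1) (l + 1)))
       + (if l = 0 then 0 else (real k + 1) * K n (k + 1) (l - 1))
     else 0)"

definition delta :: "nat \<Rightarrow> nat" where
  "delta n = (if even n then 0 else 1)"

lemma fact_quotient_Ints: "1 / 2 ^ k * (fact (2 * k + l) / (fact k * fact l)) \<in> (\<int> :: real set)"
proof -
  have dbl: "(fact (2 * k) :: real) / (2 ^ k * fact k) \<in> \<int>"
  proof (induction k)
    case (Suc k)
    have eq: "2 * (k1 * (m * F)) / (2 * c * (k1 * f)) = m * (F / (c * f))"
      if "k1 > 0" "c > 0" "f > 0" for k1 m F c f :: real
      using that by simp
    have "(fact (2 * Suc k) :: real) = 2 * ((real k + 1) * ((2 * real k + 1) * fact (2 * k)))"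
      by (simp add: algebra_simps)
    moreover have "(2 :: real) ^ Suc k * fact (Suc k) = 2 * 2 ^ k * ((real k + 1) * fact k)"
      by simp
    ultimately have "(fact (2 * Suc k) :: real) / (2 ^ Suc k * fact (Suc k))
        = (2 * real k + 1) * (fact (2 * k) / (2 ^ k * fact k))"
      using eq[of "real k + 1" "2 ^ k" "fact k"] by (simp del: fact_Suc)
    moreover have "(2 * real k + 1) \<in> \<int>" by simp
    ultimately show ?case using Suc.IH by (metis Ints_mult)
  qed simp
  have "real ((2 * k + l) choose l) = fact (2 * k + l) / (fact l * fact (2 * k))"
    by (simp add: binomial_fact)
  then have "1 / 2 ^ k * (fact (2 * k + l) / (fact k * fact l)) =
      real ((2 * k + l) choose l) * (fact (2 * k) / (2 ^ k * fact k) :: real)"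
    by (simp add: field_simps)
  with dbl show ?thesis by (metis Ints_mult Ints_of_nat)
qed

lemma K_Ints: "K n k l \<in> \<int>"
proof (induction n arbitrary: k l)
  case (Suc n)
  have num: "real m + 1 \<in> \<int>" for m by simp
  have rec: "(if l = 0 then 0 else K n k (l - 1))
       + (real l + 1) * (K n k (l + 1) + (if k = 0 then 0 else K n (k - 1) (l + 1)))
       + (if l = 0 then 0 else (real k + 1) * K n (k + 1) (l - 1)) \<in> \<int>"
    by (cases "l = 0"; cases "k = 0"; simp only: if_True if_False refl;
        intro Ints_add Ints_mult Ints_0 Suc.IH num)
  show ?case
    unfolding K.simps using fact_quotient_Ints[of k l] rec by (metis Ints_0)
qed simp


text \<open>
  Graded graphs with root.  All graphs considered here have at most one edge between two
  vertices, so edges are given by a relation; \<open>adj G x y\<close> is the edge leading from \<open>x\<close> to the vertex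
  \<open>y\<close> one level higher.
\<close>

record 'v graded_graph =
  root :: 'v
  level :: "nat \<Rightarrow> 'v set"
  adj :: "'v \<Rightarrow> 'v \<Rightarrow> bool"

definition is_graded_graph :: "'v graded_graph \<Rightarrow> bool" where
  "is_graded_graph G \<longleftrightarrow> level G 0 = {root G} \<and>
     (\<forall>m n. m \<noteq> n \<longrightarrow> level G m \<inter> level G n = {}) \<and>
     (\<forall>x y. adj G x y \<longrightarrow> (\<exists>n. x \<in> level G n \<and> y \<in> level G (Suc n)))"

definition up :: "'v graded_graph \<Rightarrow> 'v \<Rightarrow> 'v \<Rightarrow> bool" where
  "up G x y \<longleftrightarrow> (\<exists>n. x \<in> level G n \<and> y \<in> level G (Suc n)) \<and> adj G x y"

definition fin_path :: "'v graded_graph \<Rightarrow> 'v list \<Rightarrow> bool" where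
  "fin_path G p \<longleftrightarrow> p \<noteq> [] \<and> hd p = root G \<and> successively (up G) p"

definition dim_path :: "'v graded_graph \<Rightarrow> 'v \<Rightarrow> nat" where
  "dim_path G x = card {p. fin_path G p \<and> last p = x}"

definition inf_paths :: "'v graded_graph \<Rightarrow> (nat \<Rightarrow> 'v) set" where
  "inf_paths G = {\<omega>. \<omega> 0 = root G \<and> (\<forall>n. up G (\<omega> n) (\<omega> (Suc n)))}"

definition path_space :: "'v graded_graph \<Rightarrow> (nat \<Rightarrow> 'v) measure" where
  "path_space G = restrict_space (PiM UNIV (\<lambda>n. count_space (level G n))) (inf_paths G)"

definition central_measure :: "'v graded_graph \<Rightarrow> (nat \<Rightarrow> 'v) measure \<Rightarrow> bool" where
  "central_measure G M \<longleftrightarrow> prob_space M \<and> sets M = sets (path_space G) \<and>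
     (\<forall>p. fin_path G p \<longrightarrow>
        measure M {\<omega> \<in> space M. \<forall>i < length p. \<omega> i = p ! i} =
        measure M {\<omega> \<in> space M. \<omega> (length p - 1) = last p} / real (dim_path G (last p)))"

text \<open>The subgraphs occurring here are induced ones, hence given by their vertex sets.\<close>

definition fully_supported_on :: "(nat \<Rightarrow> 'v) measure \<Rightarrow> 'v set \<Rightarrow> bool" where
  "fully_supported_on M V \<longleftrightarrow> measure M {\<omega> \<in> space M. \<forall>n. \<omega> n \<in> V} = 1"

lemma space_path_space:
  assumes "is_graded_graph G"
  shows "space (path_space G) = inf_paths G"
proof -
  have "\<omega> n \<in> level G n" if "\<omega> \<in> inf_paths G" for \<omega> n
  proof (induction n)
    case 0
    then show ?case using that assms by (simp add: inf_paths_def is_graded_graph_def)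
  next
    case (Suc n)
    from that obtain m where "\<omega> n \<in> level G m" "\<omega> (Suc n) \<in> level G (Suc m)"
      by (auto simp: inf_paths_def up_def)
    with Suc assms show ?case unfolding is_graded_graph_def by (metis disjoint_iff)
  qed
  then show ?thesis
    by (auto simp: path_space_def space_restrict_space space_PiM)
qed

text \<open>
  At most one of \<open>adj G x y\<close>, \<open>adj G y x\<close> holds in a graded graph, so the pascalization of a graph
  without multiple edges has no multiple edges either.
\<close>

definition pascalization :: "'v graded_graph \<Rightarrow> (nat \<times> 'v) graded_graph" where
  "pascalization G = \<lparr>
     root = (0, root G),
     level = (\<lambda>n. {(n, x) | x k. k \<le> n \<and> k mod 2 = n mod 2 \<and> x \<in> level G k}),
     adj = (\<lambda>(m, x) (n, y). n = Suc m \<and>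
       (\<exists>k \<le> m. k mod 2 = m mod 2 \<and> x \<in> level G k) \<and> (adj G x y \<or> adj G y x)) \<rparr>"

text \<open>The vertex set of \<open>G\<close> viewed as a subgraph of its pascalization.\<close>

definition in_pascalization :: "'v graded_graph \<Rightarrow> (nat \<times> 'v) set" where
  "in_pascalization G = {(n, x) | n x. x \<in> level G n}"

lemma is_graded_graph_pascalization:
  assumes G: "is_graded_graph G"
  shows "is_graded_graph (pascalization G)"
proof -
  have lv: "(j = Suc k \<or> k = Suc j)"
    if a: "adj G x y \<or> adj G y x" and k: "x \<in> level G k" and j: "y \<in> level G j" for x y k j
  proof -
    from G a obtain i where
      "x \<in> level G i \<and> y \<in> level G (Suc i) \<or> y \<in> level G i \<and> x \<in> level G (Suc i)"
      unfolding is_graded_graph_def by blast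
    with G k j show ?thesis unfolding is_graded_graph_def by (metis disjoint_iff)
  qed
  have "\<exists>n. x \<in> level (pascalization G) n \<and> y \<in> level (pascalization G) (Suc n)"
    if xy: "adj (pascalization G) x y" for x y
  proof -
    obtain m u v where *: "x = (m, u)" "y = (Suc m, v)" "adj G u v \<or> adj G v u"
      and "\<exists>k \<le> m. k mod 2 = m mod 2 \<and> u \<in> level G k"
      using xy by (cases x; cases y) (auto simp: pascalization_def)
    then obtain k where k: "k \<le> m" "k mod 2 = m mod 2" "u \<in> level G k" by blast
    obtain j where j: "v \<in> level G j" using G *(3) unfolding is_graded_graph_def by blast
    have jk: "j = Suc k \<or> k = Suc j" using lv[OF *(3) k(3) j] .
    have "even k = even m" using k(2) by (simp add: even_iff_mod_2_eq_zero)
    with jk have "even j = even (Suc m)" by auto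
    then have "j mod 2 = Suc m mod 2" by (simp only: mod2_eq_if)
    moreover have "j \<le> Suc m" using jk k(1) by auto
    ultimately have "y \<in> level (pascalization G) (Suc m)"
      using * j unfolding pascalization_def graded_graph.simps by blast
    moreover have "x \<in> level (pascalization G) m"
      using * k unfolding pascalization_def graded_graph.simps by blast
    ultimately show ?thesis by blast
  qed
  moreover have "level (pascalization G) 0 = {root (pascalization G)}"
    using G by (auto simp: pascalization_def is_graded_graph_def)
  moreover have "level (pascalization G) m \<inter> level (pascalization G) n = {}" if "m \<noteq> n" for m n
    using that by (auto simp: pascalization_def)
  ultimately show ?thesis unfolding is_graded_graph_def by blast
qed


text \<open>A Young diagram is the finite down-closed set of its boxes \<open>(row, column)\<close>.\<close>

type_synonym diagram = "(nat \<times> nat) set"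

definition young_diagram :: "diagram \<Rightarrow> bool" where
  "young_diagram \<mu> \<longleftrightarrow> finite \<mu> \<and>
     (\<forall>i j i' j'. (i, j) \<in> \<mu> \<longrightarrow> i' \<le> i \<longrightarrow> j' \<le> j \<longrightarrow> (i', j') \<in> \<mu>)"

definition diagrams :: "nat \<Rightarrow> diagram set" where
  "diagrams n = {\<mu>. young_diagram \<mu> \<and> card \<mu> = n}"

definition add_box :: "diagram \<Rightarrow> diagram \<Rightarrow> bool" where
  "add_box \<mu> \<mu>' \<longleftrightarrow> young_diagram \<mu> \<and> young_diagram \<mu>' \<and> (\<exists>b. b \<notin> \<mu> \<and> \<mu>' = insert b \<mu>)"

definition young_graph :: "diagram graded_graph" where
  "young_graph = \<lparr> root = {}, level = diagrams, adj = add_box \<rparr>"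

definition coupled_young_graph :: "(diagram \<times> diagram) graded_graph" where
  "coupled_young_graph = \<lparr>
     root = ({}, {}),
     level = (\<lambda>n. \<Union>k \<in> {0..n div 2}. diagrams k \<times> diagrams (n - 2 * k)),
     adj = (\<lambda>(\<nu>1, \<mu>1) (\<nu>2, \<mu>2). young_diagram \<nu>1 \<and>
       (\<nu>2 = \<nu>1 \<and> add_box \<mu>1 \<mu>2 \<or> add_box \<nu>1 \<nu>2 \<and> add_box \<mu>2 \<mu>1)) \<rparr>"

text \<open>
  The vertices \<open>(n, (\<emptyset>, \<mu>))\<close>, \<open>\<mu>\<close> a diagram with \<open>n\<close> boxes: the Young graph viewed inside
  the pascalization of the coupled Young graph.
\<close>

definition young_in_pascalization :: "(nat \<times> diagram \<times> diagram) set" where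
  "young_in_pascalization = {(n, ({}, \<mu>)) | n \<mu>. \<mu> \<in> level young_graph n}"

lemma diagrams_0: "diagrams 0 = {{}}"
  by (auto simp: diagrams_def young_diagram_def)

lemma young_in_coupled: "young_in_pascalization \<subseteq> in_pascalization coupled_young_graph"
  by (force simp: young_in_pascalization_def in_pascalization_def young_graph_def
      coupled_young_graph_def diagrams_0)

lemma add_box_card: "add_box \<mu> \<mu>' \<Longrightarrow> card \<mu>' = Suc (card \<mu>)"
  by (auto simp: add_box_def young_diagram_def)

lemma is_graded_graph_young: "is_graded_graph young_graph"
  using add_box_card
  by (auto simp: is_graded_graph_def young_graph_def diagrams_0)
    (auto simp: diagrams_def add_box_def)

lemma level_coupled_iff:
  "(\<nu>1, \<mu>1) \<in> level coupled_young_graph n \<longleftrightarrow>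
     young_diagram \<nu>1 \<and> young_diagram \<mu>1 \<and> 2 * card \<nu>1 + card \<mu>1 = n"
  by (auto simp: coupled_young_graph_def diagrams_def)

lemma is_graded_graph_coupled: "is_graded_graph coupled_young_graph"
proof -
  have "\<exists>n. x \<in> level coupled_young_graph n \<and> y \<in> level coupled_young_graph (Suc n)"
    if "adj coupled_young_graph x y" for x y
  proof -
    obtain \<nu>1 \<mu>1 \<nu>2 \<mu>2 where xy: "x = (\<nu>1, \<mu>1)" "y = (\<nu>2, \<mu>2)" by (cases x; cases y) auto
    from that have "young_diagram \<nu>1"
        "\<nu>2 = \<nu>1 \<and> add_box \<mu>1 \<mu>2 \<or> add_box \<nu>1 \<nu>2 \<and> add_box \<mu>2 \<mu>1"
      unfolding xy by (auto simp: coupled_young_graph_def)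
    then show ?thesis unfolding xy level_coupled_iff
      by (auto simp: add_box_card) (auto simp: add_box_def)
  qed
  moreover have "level coupled_young_graph 0 = {root coupled_young_graph}"
    by (simp add: coupled_young_graph_def diagrams_0)
  moreover have "level coupled_young_graph m \<inter> level coupled_young_graph n = {}" if "m \<noteq> n" for m n
    using that by (auto simp: level_coupled_iff)
  ultimately show ?thesis unfolding is_graded_graph_def by blast
qed

end

theory Submission
  imports Defs
begin

text \<open>
  A path in the pascalization is a walk in the coupled Young graph \<open>\<Theta>\<close> that may go up and down.  Let \<open>M\<close> be a
  central measure and let \<open>weight n x\<close> be the probability that the \<open>n\<close>-th vertex is \<open>x\<close>, divided by
  the number of paths to \<open>x\<close>.  By centrality this is the probability of each path to \<open>x\<close>, so the weight is
  harmonic (\<open>weight_eq_sum\<close>) and does not increase along edges.  Hence it suffices to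
  find, for each subgraph, one vertex of weight 0 from which everything outside the subgraph can be reached.

  To see that a vertex \<open>v\<close> has weight 0, count the paths through \<open>v\<close>.  These counts satisfy the recursion
  adjoint to harmonicity, so their pairing with the weight is the same on every level
  (\<open>sum_weight_invariant\<close>).  If, for some late level, the paths through \<open>v\<close> are an
  arbitrarily small fraction of all paths to each vertex of that level, this pairing
  vanishes (\<open>weight_eq_0\<close>).

  The path counts are explicit: there are \<open>K n k l\<close> times the numbers of standard
  tableaux of \<open>\<nu>\<close> and \<open>\<mu>\<close> paths to \<open>(n, (\<nu>, \<mu>))\<close>, where \<open>k\<close> and \<open>l\<close> are the sizes of the two diagrams
  (\<open>dim_path_coupled_pascal\<close>).  This rests on the commutation relation of Young's lattice, by which the numbers of
  tableaux of all diagrams \<open>\<mu>'\<close> with one box more than \<open>\<mu>\<close> add up to \<open>l + 1\<close> times that of \<open>\<mu>\<close> (\<open>sum_box_above\<close>).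

  For \<open>\<Theta>\<close>, take \<open>v\<close> to be the return to the root after two steps.  The fraction of paths through it is
  \<open>K (n - 2) k l / K n k l\<close>.  By the monotonicity hypothesis it is at most \<open>K (n - 2) 0 0 / K n 0 0\<close> for
  even \<open>n\<close>, and these ratios are not bounded away from 0, since \<open>K (2 * m) 0 0\<close> is at least
  \<open>fact m\<close> and so grows faster than geometrically.  Every vertex outside \<open>\<Theta>\<close> can be reached from \<open>v\<close>.

  For the Young graph, take \<open>v\<close> to be the vertex of level 2 whose first diagram is a single box.  Only paths within \<open>\<Theta>\<close> matter
  now.  Up to the numbers of tableaux, those to \<open>(\<nu>, \<mu>)\<close> are as many as the selections of \<open>k\<close> disjoint pairs
  from \<open>n\<close> points, and those through \<open>v\<close> as many as the selections that contain one prescribed pair, which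
  are a fraction of at most \<open>1 / (n - 1)\<close>.
\<close>

section \<open>Path counts in graded graphs and harmonic weights of central measures\<close>

text \<open>
  All levels are required to be finite, so that path counts, sums over a level and the
  decompositions of events below are finite.
\<close>

locale finite_level_graph =
  fixes G :: "'v graded_graph"
  assumes graded: "is_graded_graph G" and finite_level: "finite (level G n)"
begin

lemma level_unique: "x \<in> level G m \<Longrightarrow> x \<in> level G n \<Longrightarrow> m = n"
  using graded unfolding is_graded_graph_def by blast

lemma level_0: "level G 0 = {root G}"
  using graded unfolding is_graded_graph_def by blast

lemma up_iff_adj: "up G x y \<longleftrightarrow> adj G x y"
  using graded unfolding is_graded_graph_def up_def by blast

lemma up_levelD: "up G x y \<Longrightarrow> x \<in> level G n \<Longrightarrow> y \<in> level G (Suc n)"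
  unfolding up_def using level_unique by metis

lemma up_levelD2: "up G x y \<Longrightarrow> y \<in> level G (Suc n) \<Longrightarrow> x \<in> level G n"
  unfolding up_def using level_unique by (metis nat.inject)

lemma fin_path_snoc:
  "fin_path G (p @ [y]) \<longleftrightarrow> (if p = [] then y = root G else fin_path G p \<and> up G (last p) y)"
  by (auto simp: fin_path_def successively_append_iff)

lemma fin_path_last_level: "fin_path G p \<Longrightarrow> last p \<in> level G (length p - 1)"
proof (induction p rule: rev_induct)
  case (snoc y p)
  show ?case
  proof (cases "p = []")
    case True
    then show ?thesis using snoc.prems by (simp add: fin_path_def level_0)
  next
    case False
    then have "fin_path G p" "up G (last p) y" using snoc.prems by (auto simp: fin_path_snoc)
    with snoc.IH False up_levelD show ?thesis by fastforce
  qed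
qed (simp add: fin_path_def)

lemma length_fin_path:
  "fin_path G p \<Longrightarrow> last p \<in> level G n \<Longrightarrow> length p = Suc n"
  using fin_path_last_level[of p] level_unique by (cases p) (auto simp: fin_path_def)

definition paths_to :: "'v \<Rightarrow> 'v list set" where
  "paths_to x = {p. fin_path G p \<and> last p = x}"

definition preds :: "'v \<Rightarrow> 'v set" where
  "preds y = {x. up G x y}"

lemma preds_subset: "y \<in> level G (Suc n) \<Longrightarrow> preds y \<subseteq> level G n"
  using up_levelD2 by (auto simp: preds_def)

lemma finite_preds: "finite (preds y)"
proof (cases "\<exists>n. y \<in> level G (Suc n)")
  case True
  then show ?thesis using preds_subset finite_level finite_subset by metis
next
  case False
  then have "preds y = {}" by (auto simp: preds_def up_def)
  then show ?thesis by simp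
qed

lemma paths_to_root: "paths_to (root G) = {[root G]}"
proof -
  have "p = [root G]" if "fin_path G p" "last p = root G" for p
  proof -
    have "length p = Suc 0" using length_fin_path[OF that(1), of 0] that(2) by (simp add: level_0)
    then obtain x where "p = [x]" by (cases p) auto
    with that(2) show ?thesis by simp
  qed
  moreover have "fin_path G [root G]" by (simp add: fin_path_def)
  ultimately have "fin_path G p \<and> last p = root G \<longleftrightarrow> p = [root G]" for p by (metis last.simps)
  then show ?thesis by (simp add: paths_to_def)
qed

lemma paths_to_Suc:
  assumes y: "y \<in> level G (Suc n)"
  shows "paths_to y = (\<Union>x\<in>preds y. (\<lambda>p. p @ [y]) ` paths_to x)"
proof (intro equalityI subsetI)
  fix p assume p: "p \<in> paths_to y"
  then have "length p = Suc (Suc n)" using length_fin_path y by (auto simp: paths_to_def)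
  with p obtain q where q: "p = q @ [y]" "q \<noteq> []"
    by (cases p rule: rev_cases) (force simp: paths_to_def)+
  with p have "q \<in> paths_to (last q)" "last q \<in> preds y"
    by (auto simp: paths_to_def preds_def fin_path_snoc)
  with q show "p \<in> (\<Union>x\<in>preds y. (\<lambda>p. p @ [y]) ` paths_to x)" by blast
next
  fix p assume "p \<in> (\<Union>x\<in>preds y. (\<lambda>p. p @ [y]) ` paths_to x)"
  then obtain q where "fin_path G q" "up G (last q) y" "p = q @ [y]"
    by (auto simp: paths_to_def preds_def)
  moreover have "q \<noteq> []" using \<open>fin_path G q\<close> by (simp add: fin_path_def)
  ultimately show "p \<in> paths_to y" by (simp add: paths_to_def fin_path_snoc)
qed

lemma finite_paths_to: "x \<in> level G n \<Longrightarrow> finite (paths_to x)"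
proof (induction n arbitrary: x)
  case 0
  then show ?case by (simp add: level_0 paths_to_root)
next
  case (Suc n)
  have "finite (paths_to w)" if "w \<in> preds x" for w
    using that preds_subset[OF Suc.prems] Suc.IH by blast
  then show ?case unfolding paths_to_Suc[OF Suc.prems] by (simp add: finite_preds)
qed

lemma dim_path_root: "dim_path G (root G) = 1"
  using paths_to_root by (simp add: dim_path_def paths_to_def)

text \<open>
  A path to a vertex of positive level is a path to one of its predecessors, extended by one step.
\<close>

lemma dim_path_Suc:
  assumes y: "y \<in> level G (Suc n)"
  shows "dim_path G y = (\<Sum>x\<in>preds y. dim_path G x)"
proof -
  have "dim_path G y = card (paths_to y)" by (simp add: dim_path_def paths_to_def)
  also have "\<dots> = card (\<Union>x\<in>preds y. (\<lambda>p. p @ [y]) ` paths_to x)"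
    by (simp only: paths_to_Suc[OF y])
  also have "\<dots> = (\<Sum>x\<in>preds y. card ((\<lambda>p. p @ [y]) ` paths_to x))"
  proof (rule card_UN_disjoint)
    show "\<forall>x\<in>preds y. finite ((\<lambda>p. p @ [y]) ` paths_to x)"
      using finite_paths_to preds_subset[OF y] by blast
  qed (auto simp: paths_to_def finite_preds)
  also have "\<dots> = (\<Sum>x\<in>preds y. dim_path G x)"
    by (intro sum.cong refl) (simp add: card_image inj_on_def dim_path_def paths_to_def)
  finally show ?thesis .
qed

end

text \<open>
  Reachability of all vertices excludes division by zero in the definition of centrality.
\<close>

locale central_measure_on = finite_level_graph G for G :: "'v graded_graph" +
  fixes M :: "(nat \<Rightarrow> 'v) measure"
  assumes central: "central_measure G M"
    and reachable: "x \<in> level G n \<Longrightarrow> dim_path G x > 0"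
begin

sublocale prob_space M
  using central by (simp add: central_measure_def)

lemma space_M: "space M = inf_paths G"
  using central sets_eq_imp_space_eq space_path_space[OF graded]
  by (metis central_measure_def)

lemma coordinate_measurable [measurable]: "(\<lambda>\<omega>. \<omega> n) \<in> M \<rightarrow>\<^sub>M count_space (level G n)"
proof -
  have "sets M = sets (path_space G)" using central by (simp add: central_measure_def)
  moreover have "(\<lambda>\<omega>. \<omega> n) \<in> path_space G \<rightarrow>\<^sub>M count_space (level G n)"
    unfolding path_space_def
    by (intro measurable_restrict_space1 measurable_component_singleton) simp
  ultimately show ?thesis by (simp add: measurable_cong_sets)
qed

lemma coordinate_event: "{\<omega> \<in> space M. P (\<omega> n)} \<in> events"
proof -
  have "Measurable.pred (count_space (level G n)) P" by simp
  from measurable_compose[OF coordinate_measurable this] show ?thesis by (simp add: pred_def)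
qed

lemma coordinate_level: "\<omega> \<in> space M \<Longrightarrow> \<omega> n \<in> level G n"
  using measurable_space[OF coordinate_measurable] by simp

text \<open>
  By centrality this is the probability of each single path that leads to \<open>x\<close>, so a central
  measure is determined by this function.
\<close>

definition weight :: "nat \<Rightarrow> 'v \<Rightarrow> real" where
  "weight n x = prob {\<omega> \<in> space M. \<omega> n = x} / real (dim_path G x)"

lemma weight_nonneg: "weight n x \<ge> 0"
  by (simp add: weight_def)

lemma prob_coordinate:
  "x \<in> level G n \<Longrightarrow> prob {\<omega> \<in> space M. \<omega> n = x} = real (dim_path G x) * weight n x"
  using reachable by (force simp: weight_def)

lemma sum_dim_weight: "(\<Sum>x\<in>level G n. real (dim_path G x) * weight n x) = 1"
proof -
  have "(\<Sum>x\<in>level G n. real (dim_path G x) * weight n x)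
      = (\<Sum>x\<in>level G n. prob {\<omega> \<in> space M. \<omega> n = x})"
    by (simp add: prob_coordinate)
  also have "\<dots> = prob (\<Union>x\<in>level G n. {\<omega> \<in> space M. \<omega> n = x})"
    by (rule finite_measure_finite_Union[symmetric])
      (auto simp: finite_level disjoint_family_on_def intro: coordinate_event)
  also have "(\<Union>x\<in>level G n. {\<omega> \<in> space M. \<omega> n = x}) = space M"
    using coordinate_level by auto
  finally show ?thesis by (simp add: prob_space)
qed

text \<open>
  Harmonicity: the cylinder of a path to \<open>x\<close> is the disjoint union of the cylinders of its one-step
  prolongations.
\<close>

lemma weight_eq_sum:
  assumes x: "x \<in> level G n"
  shows "weight n x = (\<Sum>y\<in>{y \<in> level G (Suc n). up G x y}. weight (Suc n) y)"
proof -
  define cyl where "cyl q = {\<omega> \<in> space M. \<forall>i < length q. \<omega> i = q ! i}" for q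
  have "paths_to x \<noteq> {}"
    using reachable[OF x] unfolding dim_path_def paths_to_def by (metis card.empty less_irrefl)
  then obtain p where p: "fin_path G p" "last p = x" by (auto simp: paths_to_def)
  have len: "length p = Suc n" using length_fin_path p x by auto
  have prob_cyl: "prob (cyl q) = weight (length q - 1) (last q)" if "fin_path G q" for q
    using central that by (auto simp: central_measure_def cyl_def weight_def)
  have cyl_event: "cyl q \<in> events" for q
    unfolding cyl_def
    by (intro sets.sets_Collect_countable_All sets.sets_Collect_imp sets.sets_Collect_const
        coordinate_event)
  have px: "p ! n = x" using p len by (metis diff_Suc_1 last_conv_nth list.size(3) nat.distinct(1))
  have cyl_snoc: "cyl (p @ [y]) = {\<omega> \<in> cyl p. \<omega> (Suc n) = y}" for y
    by (auto simp: cyl_def len nth_append less_Suc_eq)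
  let ?S = "{y \<in> level G (Suc n). up G x y}"
  have "cyl p = (\<Union>y\<in>?S. cyl (p @ [y]))"
  proof -
    have "up G x (\<omega> (Suc n))" if "\<omega> \<in> cyl p" for \<omega>
    proof -
      have "\<omega> n = x" using that px len by (simp add: cyl_def)
      moreover have "up G (\<omega> n) (\<omega> (Suc n))"
        using that by (simp add: cyl_def space_M inf_paths_def)
      ultimately show ?thesis by simp
    qed
    then show ?thesis using coordinate_level by (auto simp: cyl_snoc) (auto simp: cyl_def)
  qed
  then have "weight n x = prob (\<Union>y\<in>?S. cyl (p @ [y]))"
    using prob_cyl[OF p(1)] p len by simp
  also have "\<dots> = (\<Sum>y\<in>?S. prob (cyl (p @ [y])))"
  proof (rule finite_measure_finite_Union)
    show "disjoint_family_on (\<lambda>y. cyl (p @ [y])) ?S"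
      by (auto simp: disjoint_family_on_def cyl_snoc)
  qed (use cyl_event in \<open>auto simp: finite_level\<close>)
  also have "\<dots> = (\<Sum>y\<in>?S. weight (Suc n) y)"
  proof (intro sum.cong refl)
    fix y assume "y \<in> ?S"
    with p len have "fin_path G (p @ [y])" by (auto simp: fin_path_snoc)
    from prob_cyl[OF this] show "prob (cyl (p @ [y])) = weight (Suc n) y" by (simp add: len)
  qed
  finally show ?thesis .
qed

text \<open>
  This is how a vanishing weight spreads: if no path passes through \<open>x\<close> with positive
  probability, then, by centrality, the same holds for each vertex that can be reached from \<open>x\<close>.
\<close>

lemma weight_antimono:
  assumes "x \<in> level G n" "up G x y"
  shows "weight (Suc n) y \<le> weight n x"
  unfolding weight_eq_sum[OF assms(1)]
  using assms up_levelD by (intro member_le_sum) (auto simp: weight_nonneg finite_level)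

text \<open>
  The weight is harmonic for steps upwards, and \<open>W\<close> satisfies the adjoint recursion, which
  sums over predecessors.  Hence their pairing over a level does not depend on the level.  With
  \<open>W\<close> the number of paths through a given vertex, this is the decomposition of its probability
  along the vertices of a later level.  The recursion is required only where the weight does not
  vanish, since the other terms do not contribute.
\<close>

lemma sum_weight_invariant:
  assumes rec: "\<And>n y. m \<le> n \<Longrightarrow> y \<in> level G (Suc n) \<Longrightarrow> weight (Suc n) y \<noteq> 0 \<Longrightarrow>
      W (Suc n) y = (\<Sum>x\<in>preds y. W n x)"
    and "m \<le> n"
  shows "(\<Sum>y\<in>level G n. W n y * weight n y) = (\<Sum>x\<in>level G m. W m x * weight m x)"
  using \<open>m \<le> n\<close>
proof (induction n rule: dec_induct)
  case (step n)
  have "(\<Sum>y\<in>level G (Suc n). W (Suc n) y * weight (Suc n) y)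
      = (\<Sum>y\<in>level G (Suc n). \<Sum>x\<in>{x \<in> level G n. up G x y}. W n x * weight (Suc n) y)"
  proof (intro sum.cong refl)
    fix y assume y: "y \<in> level G (Suc n)"
    have "preds y = {x \<in> level G n. up G x y}"
      using preds_subset[OF y] by (auto simp: preds_def)
    then show "W (Suc n) y * weight (Suc n) y
        = (\<Sum>x\<in>{x \<in> level G n. up G x y}. W n x * weight (Suc n) y)"
      using rec[OF step.hyps(1) y] by (cases "weight (Suc n) y = 0") (auto simp: sum_distrib_right)
  qed
  also have "\<dots> = (\<Sum>x\<in>level G n. \<Sum>y\<in>{y \<in> level G (Suc n). up G x y}. W n x * weight (Suc n) y)"
    by (rule sum.swap_restrict) (simp_all add: finite_level)
  also have "\<dots> = (\<Sum>x\<in>level G n. W n x * weight n x)"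
    by (simp add: weight_eq_sum sum_distrib_left)
  finally show ?case using step.IH by simp
qed simp

text \<open>
  If the paths counted by \<open>W\<close> form an arbitrarily small fraction of all paths to each vertex of
  some late level, then the pairing of \<open>W\<close> with the weight, being independent of the level, is 0.
\<close>

lemma weight_eq_0:
  assumes rec: "\<And>n y. m \<le> n \<Longrightarrow> y \<in> level G (Suc n) \<Longrightarrow> weight (Suc n) y \<noteq> 0 \<Longrightarrow>
      W (Suc n) y = (\<Sum>x\<in>preds y. W n x)"
    and nonneg: "\<And>x. W m x \<ge> (0 :: real)"
    and v: "v \<in> level G m" "W m v > 0"
    and small: "\<And>\<epsilon>. \<epsilon> > 0 \<Longrightarrow> \<exists>N\<ge>m. \<forall>y\<in>level G N. weight N y \<noteq> 0 \<longrightarrow>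
      W N y \<le> \<epsilon> * real (dim_path G y)"
  shows "weight m v = 0"
proof -
  have "W m v * weight m v \<le> 0 + \<epsilon>" if \<epsilon>: "\<epsilon> > 0" for \<epsilon>
  proof -
    obtain N where N: "N \<ge> m"
      "\<And>y. y \<in> level G N \<Longrightarrow> weight N y \<noteq> 0 \<Longrightarrow> W N y \<le> \<epsilon> * real (dim_path G y)"
      using small[OF \<epsilon>] by blast
    have "W m v * weight m v \<le> (\<Sum>x\<in>level G m. W m x * weight m x)"
      using v nonneg weight_nonneg finite_level
      by (intro member_le_sum[where f = "\<lambda>x. W m x * weight m x"]) auto
    also have "\<dots> = (\<Sum>y\<in>level G N. W N y * weight N y)"
      using sum_weight_invariant[where m = m and n = N and W = W] rec N(1) by simp
    also have "\<dots> \<le> (\<Sum>y\<in>level G N. \<epsilon> * (real (dim_path G y) * weight N y))"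
    proof (intro sum_mono)
      fix y assume y: "y \<in> level G N"
      show "W N y * weight N y \<le> \<epsilon> * (real (dim_path G y) * weight N y)"
        using mult_right_mono[OF N(2)[OF y] weight_nonneg[of N y]]
        by (cases "weight N y = 0") (simp_all add: mult.assoc)
    qed
    also have "\<dots> = \<epsilon>" by (simp add: sum_dim_weight flip: sum_distrib_left)
    finally show ?thesis by simp
  qed
  then have "W m v * weight m v \<le> 0" by (rule field_le_epsilon)
  with v(2) weight_nonneg[of m v] show ?thesis by (simp add: mult_le_0_iff)
qed

lemma fully_supported_onI:
  assumes "\<And>n x. x \<in> level G n \<Longrightarrow> x \<notin> V \<Longrightarrow> weight n x = 0"
  shows "fully_supported_on M V"
proof -
  have "AE \<omega> in M. \<omega> n \<in> V" for n
  proof -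
    have "AE \<omega> in M. \<forall>x\<in>level G n - V. \<omega> n \<noteq> x"
    proof (subst AE_finite_all)
      show "\<forall>x\<in>level G n - V. AE \<omega> in M. \<omega> n \<noteq> x"
      proof
        fix x assume "x \<in> level G n - V"
        then have "prob {\<omega> \<in> space M. \<omega> n = x} = 0"
          using assms prob_coordinate by auto
        then show "AE \<omega> in M. \<omega> n \<noteq> x"
          using coordinate_event[of "\<lambda>z. z = x" n] by (simp add: prob_Collect_eq_0)
      qed
    qed (simp add: finite_level)
    then show ?thesis
      by (rule AE_mp) (use coordinate_level in auto)
  qed
  then have "AE \<omega> in M. \<forall>n. \<omega> n \<in> V" by (simp add: AE_all_countable)
  moreover have "{\<omega> \<in> space M. \<forall>n. \<omega> n \<in> V} \<in> events"
    by (intro sets.sets_Collect_countable_All coordinate_event)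
  ultimately show ?thesis by (simp add: fully_supported_on_def prob_Collect_eq_1)
qed

end

section \<open>Young diagrams and numbers of standard tableaux\<close>

lemma young_diagramD:
  "young_diagram \<mu> \<Longrightarrow> (i, j) \<in> \<mu> \<Longrightarrow> i' \<le> i \<Longrightarrow> j' \<le> j \<Longrightarrow> (i', j') \<in> \<mu>"
  unfolding young_diagram_def by blast

lemma young_diagramI:
  assumes "finite \<mu>" "\<And>i j i' j'. (i, j) \<in> \<mu> \<Longrightarrow> i' \<le> i \<Longrightarrow> j' \<le> j \<Longrightarrow> (i', j') \<in> \<mu>"
  shows "young_diagram \<mu>"
  unfolding young_diagram_def
proof (intro conjI allI impI)
  fix i j i' j' assume "(i, j) \<in> \<mu>" "i' \<le> i" "j' \<le> j"
  then show "(i', j') \<in> \<mu>" by (rule assms(2))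
qed (rule assms(1))

lemma add_boxI:
  "young_diagram \<mu> \<Longrightarrow> young_diagram \<nu> \<Longrightarrow> b \<notin> \<mu> \<Longrightarrow> \<nu> = insert b \<mu> \<Longrightarrow> add_box \<mu> \<nu>"
  unfolding add_box_def by blast

definition box_below :: "diagram \<Rightarrow> diagram set" where
  "box_below \<mu> = {\<kappa>. add_box \<kappa> \<mu>}"

definition box_above :: "diagram \<Rightarrow> diagram set" where
  "box_above \<mu> = {\<nu>. add_box \<mu> \<nu>}"

definition row_len :: "diagram \<Rightarrow> nat \<Rightarrow> nat" where
  "row_len \<mu> i = card {j. (i, j) \<in> \<mu>}"

lemma mem_iff_row_len:
  assumes "young_diagram \<mu>"
  shows "(i, j) \<in> \<mu> \<longleftrightarrow> j < row_len \<mu> i"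
proof -
  let ?R = "{j. (i, j) \<in> \<mu>}"
  have "finite (snd ` \<mu>)" using assms by (simp add: young_diagram_def)
  moreover have "?R \<subseteq> snd ` \<mu>" by force
  ultimately have fin: "finite ?R" by (rule finite_subset[rotated])
  have down: "j' \<in> ?R" if "j \<in> ?R" "j' \<le> j" for j j'
    using assms that unfolding young_diagram_def by blast
  have "?R = {..<card ?R}"
  proof (cases "?R = {}")
    case False
    define m where "m = Max ?R"
    have "m \<in> ?R" "\<And>j. j \<in> ?R \<Longrightarrow> j \<le> m"
      unfolding m_def using Max_in[OF fin False] Max_ge[OF fin] by blast+
    with down have "?R = {..m}" by blast
    then show ?thesis by (simp add: lessThan_Suc_atMost)
  qed simp
  then show ?thesis unfolding row_len_def by blast
qed

lemma row_len_antimono: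
  assumes "young_diagram \<mu>" "i \<le> i'"
  shows "row_len \<mu> i' \<le> row_len \<mu> i"
proof (rule ccontr)
  assume "\<not> row_len \<mu> i' \<le> row_len \<mu> i"
  then have "(i', row_len \<mu> i) \<in> \<mu>" by (simp add: mem_iff_row_len[OF assms(1)])
  then have "(i, row_len \<mu> i) \<in> \<mu>" using assms unfolding young_diagram_def by blast
  then show False by (simp add: mem_iff_row_len[OF assms(1)])
qed

text \<open>
  The rows whose last box is a corner.
\<close>

definition descents :: "diagram \<Rightarrow> nat set" where
  "descents \<mu> = {i. row_len \<mu> (Suc i) < row_len \<mu> i}"

lemma finite_descents:
  assumes "young_diagram \<mu>"
  shows "finite (descents \<mu>)"
proof -
  have "descents \<mu> \<subseteq> fst ` \<mu>"
  proof
    fix i assume "i \<in> descents \<mu>"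
    then have "(i, 0) \<in> \<mu>" by (simp add: descents_def mem_iff_row_len[OF assms])
    then show "i \<in> fst ` \<mu>" by force
  qed
  moreover have "finite (fst ` \<mu>)" using assms by (simp add: young_diagram_def)
  ultimately show ?thesis by (rule finite_subset)
qed

text \<open>
  A box can be added exactly at the end of the top row and of the rows below a descent.
\<close>

lemma box_above_eq:
  assumes \<mu>: "young_diagram \<mu>"
  shows "box_above \<mu> = (\<lambda>i. insert (i, row_len \<mu> i) \<mu>) ` insert 0 (Suc ` descents \<mu>)"
proof (intro equalityI subsetI)
  fix \<nu> assume "\<nu> \<in> box_above \<mu>"
  then obtain i j where b: "(i, j) \<notin> \<mu>" "\<nu> = insert (i, j) \<mu>" "young_diagram \<nu>"
    by (auto simp: box_above_def add_box_def)
  have ge: "row_len \<mu> i \<le> j" using b(1) by (simp add: mem_iff_row_len[OF \<mu>])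
  have "(i, row_len \<mu> i) \<in> \<nu>" using b ge unfolding young_diagram_def by blast
  then have j: "j = row_len \<mu> i" using b by (auto simp: mem_iff_row_len[OF \<mu>])
  have "i \<in> insert 0 (Suc ` descents \<mu>)"
  proof (cases i)
    case (Suc i')
    have "(i', j) \<in> \<nu>" using b Suc unfolding young_diagram_def by (metis insertI1 le_refl lessI less_imp_le)
    then have "(i', j) \<in> \<mu>" using b Suc by auto
    then show ?thesis using j Suc by (auto simp: mem_iff_row_len[OF \<mu>] descents_def)
  qed simp
  with b j show "\<nu> \<in> (\<lambda>i. insert (i, row_len \<mu> i) \<mu>) ` insert 0 (Suc ` descents \<mu>)" by blast
next
  fix \<nu> assume "\<nu> \<in> (\<lambda>i. insert (i, row_len \<mu> i) \<mu>) ` insert 0 (Suc ` descents \<mu>)"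
  then obtain i where i: "i = 0 \<or> (\<exists>i'. i = Suc i' \<and> row_len \<mu> i < row_len \<mu> i')"
    and \<nu>: "\<nu> = insert (i, row_len \<mu> i) \<mu>"
    by (auto simp: descents_def)
  have "(a', b') \<in> \<nu>" if "(a, b) \<in> \<nu>" "a' \<le> a" "b' \<le> b" for a b a' b'
  proof (cases "(a, b) \<in> \<mu>")
    case True
    with that \<mu> show ?thesis unfolding \<nu> young_diagram_def by blast
  next
    case False
    then have ab: "a = i" "b = row_len \<mu> i" using that \<nu> by auto
    show ?thesis
    proof (cases "a' = i")
      case True
      then show ?thesis using that ab \<nu> by (auto simp: mem_iff_row_len[OF \<mu>])
    next
      case False
      then obtain i' where i': "i = Suc i'" "row_len \<mu> i < row_len \<mu> i'" "a' \<le> i'"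
        using i \<open>a' \<le> a\<close> ab \<open>a' \<noteq> i\<close> by (auto simp: le_Suc_eq)
      then have "b' < row_len \<mu> a'" using row_len_antimono[OF \<mu> i'(3)] that ab by linarith
      then show ?thesis using \<nu> by (simp add: mem_iff_row_len[OF \<mu>])
    qed
  qed
  moreover have "finite \<nu>" using \<mu> \<nu> by (simp add: young_diagram_def)
  ultimately have "young_diagram \<nu>" by (intro young_diagramI)
  moreover have "(i, row_len \<mu> i) \<notin> \<mu>" by (simp add: mem_iff_row_len[OF \<mu>])
  ultimately show "\<nu> \<in> box_above \<mu>"
    using \<mu> \<nu> by (auto simp: box_above_def add_box_def)
qed

lemma box_below_eq:
  assumes \<mu>: "young_diagram \<mu>"
  shows "box_below \<mu> = (\<lambda>i. \<mu> - {(i, row_len \<mu> i - 1)}) ` descents \<mu>"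
proof (intro equalityI subsetI)
  fix \<kappa> assume "\<kappa> \<in> box_below \<mu>"
  then obtain i j where b: "(i, j) \<notin> \<kappa>" "\<mu> = insert (i, j) \<kappa>" "young_diagram \<kappa>"
    by (auto simp: box_below_def add_box_def)
  have not: "(i', j') \<notin> \<mu>" if "i \<le> i'" "j \<le> j'" "(i', j') \<noteq> (i, j)" for i' j'
    using b that unfolding young_diagram_def by blast
  have "(i, j) \<in> \<mu>" using b by simp
  moreover have "(i, Suc j) \<notin> \<mu>" "(Suc i, j) \<notin> \<mu>" using not by auto
  ultimately have "j = row_len \<mu> i - 1" "i \<in> descents \<mu>"
    by (auto simp: mem_iff_row_len[OF \<mu>] descents_def)
  moreover have "\<kappa> = \<mu> - {(i, j)}" using b by auto
  ultimately show "\<kappa> \<in> (\<lambda>i. \<mu> - {(i, row_len \<mu> i - 1)}) ` descents \<mu>" by blast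
next
  fix \<kappa> assume "\<kappa> \<in> (\<lambda>i. \<mu> - {(i, row_len \<mu> i - 1)}) ` descents \<mu>"
  then obtain i where i: "row_len \<mu> (Suc i) < row_len \<mu> i"
    and \<kappa>: "\<kappa> = \<mu> - {(i, row_len \<mu> i - 1)}" by (auto simp: descents_def)
  \<comment> \<open>The removed box is the only one weakly to the south-east of it.\<close>
  have corner: "(a, b) = (i, row_len \<mu> i - 1)"
    if "(a, b) \<in> \<mu>" "i \<le> a" "row_len \<mu> i - 1 \<le> b" for a b
  proof -
    have "b < row_len \<mu> a" using that by (simp add: mem_iff_row_len[OF \<mu>])
    moreover have "row_len \<mu> a \<le> row_len \<mu> (Suc i)" if "a \<noteq> i"
      using row_len_antimono[OF \<mu>] that \<open>i \<le> a\<close> by simp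
    ultimately show ?thesis using that i by (cases "a = i") auto
  qed
  have "(a', b') \<in> \<kappa>" if "(a, b) \<in> \<kappa>" "a' \<le> a" "b' \<le> b" for a b a' b'
  proof -
    have "(a', b') \<in> \<mu>" using that \<kappa> \<mu> unfolding young_diagram_def by blast
    with that \<kappa> corner[of a b] show ?thesis by auto
  qed
  moreover have "finite \<kappa>" using \<mu> \<kappa> by (simp add: young_diagram_def)
  ultimately have "young_diagram \<kappa>" by (intro young_diagramI)
  moreover have "(i, row_len \<mu> i - 1) \<in> \<mu>" using i by (simp add: mem_iff_row_len[OF \<mu>])
  ultimately show "\<kappa> \<in> box_below \<mu>"
    using \<mu> \<kappa> by (auto simp: box_below_def add_box_def)
qed

lemma finite_box_above: "finite (box_above \<mu>)"
proof (cases "young_diagram \<mu>")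
  case True
  then show ?thesis using finite_descents by (simp add: box_above_eq)
next
  case False
  then show ?thesis by (simp add: box_above_def add_box_def)
qed

lemma finite_box_below: "finite (box_below \<mu>)"
proof (cases "young_diagram \<mu>")
  case True
  then show ?thesis using finite_descents by (simp add: box_below_eq)
next
  case False
  then show ?thesis by (simp add: box_below_def add_box_def)
qed

text \<open>
  This is the relation \<open>DU - UD = 1\<close> on the diagonal for the up and down operators of Young's lattice:
  the addable boxes lie in the top row and in the rows just below the removable ones.
\<close>

lemma card_box_above:
  assumes \<mu>: "young_diagram \<mu>"
  shows "card (box_above \<mu>) = Suc (card (box_below \<mu>))"
proof -
  have "inj (\<lambda>i. insert (i, row_len \<mu> i) \<mu>)"
  proof (rule injI)
    fix i i' assume eq: "insert (i, row_len \<mu> i) \<mu> = insert (i', row_len \<mu> i') \<mu>"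
    have "(i, row_len \<mu> i) \<notin> \<mu>" by (simp add: mem_iff_row_len[OF \<mu>])
    moreover have "(i, row_len \<mu> i) \<in> insert (i', row_len \<mu> i') \<mu>"
      by (simp only: insertI1 flip: eq)
    ultimately show "i = i'" by simp
  qed
  then have "card (box_above \<mu>) = card (insert 0 (Suc ` descents \<mu>))"
    unfolding box_above_eq[OF \<mu>] by (intro card_image) (erule inj_on_subset, simp)
  also have "\<dots> = Suc (card (descents \<mu>))"
    using finite_descents[OF \<mu>] by (subst card_insert_disjoint) (auto simp: card_image)
  also have "card (descents \<mu>) = card (box_below \<mu>)"
    unfolding box_below_eq[OF \<mu>]
  proof (rule card_image[symmetric], rule inj_onI)
    fix i i' assume i: "i \<in> descents \<mu>" and "i' \<in> descents \<mu>"
      and eq: "\<mu> - {(i, row_len \<mu> i - 1)} = \<mu> - {(i', row_len \<mu> i' - 1)}"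
    have "(i, row_len \<mu> i - 1) \<in> \<mu>"
      using i by (auto simp: mem_iff_row_len[OF \<mu>] descents_def)
    moreover have "(i, row_len \<mu> i - 1) \<notin> \<mu> - {(i', row_len \<mu> i' - 1)}"
      unfolding eq[symmetric] by blast
    ultimately show "i = i'" by simp
  qed
  finally show ?thesis .
qed

lemma young_diagram_Un:
  assumes "young_diagram \<mu>" "young_diagram \<nu>"
  shows "young_diagram (\<mu> \<union> \<nu>)"
proof (rule young_diagramI)
  show "finite (\<mu> \<union> \<nu>)" using assms by (simp add: young_diagram_def)
next
  fix i j i' j' assume "(i, j) \<in> \<mu> \<union> \<nu>" "i' \<le> i" "j' \<le> j"
  then show "(i', j') \<in> \<mu> \<union> \<nu>" using young_diagramD[OF assms(1)] young_diagramD[OF assms(2)] by blast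
qed

lemma young_diagram_Int:
  assumes "young_diagram \<mu>" "young_diagram \<nu>"
  shows "young_diagram (\<mu> \<inter> \<nu>)"
proof (rule young_diagramI)
  show "finite (\<mu> \<inter> \<nu>)" using assms by (simp add: young_diagram_def)
next
  fix i j i' j' assume "(i, j) \<in> \<mu> \<inter> \<nu>" "i' \<le> i" "j' \<le> j"
  then show "(i', j') \<in> \<mu> \<inter> \<nu>" using young_diagramD[OF assms(1)] young_diagramD[OF assms(2)] by blast
qed

lemma young_diagram_empty [simp]: "young_diagram {}"
  by (simp add: young_diagram_def)

text \<open>
  A box that maximises the sum of its coordinates is a corner.
\<close>

lemma box_below_nonempty:
  assumes \<mu>: "young_diagram \<mu>" "\<mu> \<noteq> {}"
  shows "box_below \<mu> \<noteq> {}"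
proof -
  define h where "h c = fst c + snd c" for c :: "nat \<times> nat"
  have fin: "finite (h ` \<mu>)" using \<mu> by (simp add: young_diagram_def)
  then have "Max (h ` \<mu>) \<in> h ` \<mu>" using \<mu> by (intro Max_in) auto
  then obtain b where b: "b \<in> \<mu>" "Max (h ` \<mu>) = h b" by blast
  have max: "h c \<le> h b" if "c \<in> \<mu>" for c
    using Max_ge[OF fin imageI[OF that]] b by simp
  have "young_diagram (\<mu> - {b})"
    unfolding young_diagram_def
  proof (intro conjI allI impI)
    fix i j i' j' assume *: "(i, j) \<in> \<mu> - {b}" "i' \<le> i" "j' \<le> j"
    then have "(i', j') \<in> \<mu>" using \<mu> unfolding young_diagram_def by blast
    moreover have "(i', j') \<noteq> b"
      using max[of "(i, j)"] * by (auto simp: h_def)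
    ultimately show "(i', j') \<in> \<mu> - {b}" by simp
  qed (use \<mu> in \<open>simp add: young_diagram_def\<close>)
  with \<mu>(1) b(1) have "add_box (\<mu> - {b}) \<mu>"
    unfolding add_box_def by (intro conjI exI[of _ b]) auto
  then show ?thesis by (auto simp: box_below_def)
qed

lemma finite_diagrams: "finite (diagrams n)"
proof (induction n)
  case (Suc n)
  have "diagrams (Suc n) \<subseteq> (\<Union>\<kappa>\<in>diagrams n. box_above \<kappa>)"
  proof
    fix \<mu> assume \<mu>: "\<mu> \<in> diagrams (Suc n)"
    then have "young_diagram \<mu>" "\<mu> \<noteq> {}" by (auto simp: diagrams_def)
    then obtain \<kappa> where "add_box \<kappa> \<mu>"
      using box_below_nonempty by (auto simp: box_below_def)
    then show "\<mu> \<in> (\<Union>\<kappa>\<in>diagrams n. box_above \<kappa>)"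
      using \<mu> add_box_card[of \<kappa> \<mu>] by (auto simp: diagrams_def box_above_def add_box_def)
  qed
  then show ?case using Suc finite_box_above by (auto intro: finite_subset)
qed (simp add: diagrams_0)

interpretation young: finite_level_graph young_graph
  by unfold_locales (use is_graded_graph_young finite_diagrams in \<open>auto simp: young_graph_def\<close>)

text \<open>
  Paths in the Young graph are standard tableaux.
\<close>

definition num_tableaux :: "diagram \<Rightarrow> real" where
  "num_tableaux \<mu> = real (dim_path young_graph \<mu>)"

lemma num_tableaux_empty [simp]: "num_tableaux {} = 1"
  using young.dim_path_root by (simp add: num_tableaux_def young_graph_def)

lemma sum_box_below:
  assumes "young_diagram \<mu>" "\<mu> \<noteq> {}"
  shows "(\<Sum>\<kappa>\<in>box_below \<mu>. num_tableaux \<kappa>) = num_tableaux \<mu>"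
proof -
  have "card \<mu> \<noteq> 0" using assms by (auto simp: young_diagram_def)
  then obtain n where "card \<mu> = Suc n" by (metis not0_implies_Suc)
  then have "\<mu> \<in> level young_graph (Suc n)"
    using assms by (simp add: young_graph_def diagrams_def)
  moreover have "young.preds \<mu> = box_below \<mu>"
    by (simp add: young.preds_def young.up_iff_adj box_below_def) (simp add: young_graph_def)
  ultimately show ?thesis
    using young.dim_path_Suc[of \<mu> n] by (simp add: num_tableaux_def)
qed

lemma mem_box_above_iff: "\<nu> \<in> box_above \<mu> \<longleftrightarrow> \<mu> \<in> box_below \<nu>"
  by (simp add: box_above_def box_below_def)

lemma box_below_empty [simp]: "box_below {} = {}"
  by (auto simp: box_below_def add_box_def)

lemma num_tableaux_pos: "young_diagram \<mu> \<Longrightarrow> num_tableaux \<mu> > 0"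
proof (induction "card \<mu>" arbitrary: \<mu> rule: less_induct)
  case less
  show ?case
  proof (cases "\<mu> = {}")
    case False
    have "num_tableaux \<kappa> > 0" if "\<kappa> \<in> box_below \<mu>" for \<kappa>
      using that less add_box_card[of \<kappa> \<mu>] by (auto simp: box_below_def add_box_def)
    then show ?thesis
      using sum_box_below[OF less.prems False] box_below_nonempty[OF less.prems False]
        finite_box_below sum_pos by metis
  qed simp
qed

text \<open>
  The relation \<open>DU - UD = 1\<close> off the diagonal: \<open>\<mu>'\<close> arises from \<open>\<mu>\<close> by adding a box and removing another one iff
  it arises by removing first, the intermediate diagrams being \<open>\<mu> \<union> \<mu>'\<close> and \<open>\<mu> \<inter> \<mu>'\<close>.
\<close>

lemma exchange_box:
  assumes \<mu>: "young_diagram \<mu>"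
  shows "(\<Sum>\<nu>\<in>box_above \<mu>. \<Sum>\<mu>'\<in>box_below \<nu> - {\<mu>}. g \<mu>')
    = (\<Sum>\<kappa>\<in>box_below \<mu>. \<Sum>\<mu>'\<in>box_above \<kappa> - {\<mu>}. g \<mu>')"
proof -
  have un: "add_box \<mu>' (\<mu> \<union> \<mu>') \<and> add_box \<mu> (\<mu> \<union> \<mu>') \<and> \<mu> \<inter> \<mu>' = \<kappa>"
    if "add_box \<kappa> \<mu>" "add_box \<kappa> \<mu>'" "\<mu>' \<noteq> \<mu>" for \<kappa> \<mu>'
  proof -
    obtain b where b: "b \<notin> \<kappa>" "\<mu> = insert b \<kappa>"
      using \<open>add_box \<kappa> \<mu>\<close> unfolding add_box_def by auto
    obtain c where c: "c \<notin> \<kappa>" "\<mu>' = insert c \<kappa>"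
      using \<open>add_box \<kappa> \<mu>'\<close> unfolding add_box_def by auto
    have "b \<notin> \<mu>'" "\<mu> \<union> \<mu>' = insert b \<mu>'" "c \<notin> \<mu>" "\<mu> \<union> \<mu>' = insert c \<mu>"
      using b c \<open>\<mu>' \<noteq> \<mu>\<close> by auto
    moreover have "\<mu> \<inter> \<mu>' = \<kappa>" using b c \<open>\<mu>' \<noteq> \<mu>\<close> by auto
    moreover have "young_diagram \<mu>" "young_diagram \<mu>'" "young_diagram (\<mu> \<union> \<mu>')"
      using that young_diagram_Un unfolding add_box_def by blast+
    ultimately show ?thesis
      using add_boxI[of \<mu>' "\<mu> \<union> \<mu>'" b] add_boxI[of \<mu> "\<mu> \<union> \<mu>'" c] by blast
  qed
  have int: "add_box (\<mu> \<inter> \<mu>') \<mu>' \<and> add_box (\<mu> \<inter> \<mu>') \<mu> \<and> \<mu> \<union> \<mu>' = \<nu>"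
    if "add_box \<mu> \<nu>" "add_box \<mu>' \<nu>" "\<mu>' \<noteq> \<mu>" for \<nu> \<mu>'
  proof -
    obtain b where b: "b \<notin> \<mu>" "\<nu> = insert b \<mu>"
      using \<open>add_box \<mu> \<nu>\<close> unfolding add_box_def by auto
    obtain c where c: "c \<notin> \<mu>'" "\<nu> = insert c \<mu>'"
      using \<open>add_box \<mu>' \<nu>\<close> unfolding add_box_def by auto
    have eq: "x = b \<or> x \<in> \<mu> \<longleftrightarrow> x = c \<or> x \<in> \<mu>'" for x
      using b(2) c(2) by blast
    have "b \<noteq> c"
    proof
      assume "b = c"
      with eq b(1) c(1) have "x \<in> \<mu> \<longleftrightarrow> x \<in> \<mu>'" for x by metis
      with \<open>\<mu>' \<noteq> \<mu>\<close> show False by blast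
    qed
    with eq[of b] eq[of c] have bc: "c \<in> \<mu>" "b \<in> \<mu>'" by auto
    have "\<mu> \<union> \<mu>' = \<nu>" using b c bc by blast
    moreover have "\<mu> = insert c (\<mu> \<inter> \<mu>')"
    proof (rule set_eqI)
      show "x \<in> \<mu> \<longleftrightarrow> x \<in> insert c (\<mu> \<inter> \<mu>')" for x using eq[of x] bc by auto
    qed
    moreover have "\<mu>' = insert b (\<mu> \<inter> \<mu>')"
    proof (rule set_eqI)
      show "x \<in> \<mu>' \<longleftrightarrow> x \<in> insert b (\<mu> \<inter> \<mu>')" for x using eq[of x] bc by auto
    qed
    moreover have "young_diagram \<mu>" "young_diagram \<mu>'" "young_diagram (\<mu> \<inter> \<mu>')"
      using that young_diagram_Int unfolding add_box_def by blast+
    ultimately show ?thesis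
      using add_boxI[of "\<mu> \<inter> \<mu>'" \<mu>' b] add_boxI[of "\<mu> \<inter> \<mu>'" \<mu> c] b(1) c(1) by blast
  qed
  have "(\<Sum>\<nu>\<in>box_above \<mu>. \<Sum>\<mu>'\<in>box_below \<nu> - {\<mu>}. g \<mu>')
      = (\<Sum>(\<nu>, \<mu>')\<in>(SIGMA \<nu>:box_above \<mu>. box_below \<nu> - {\<mu>}). g \<mu>')"
    by (rule sum.Sigma) (auto simp: finite_box_above finite_box_below)
  also have "\<dots> = (\<Sum>(\<kappa>, \<mu>')\<in>(SIGMA \<kappa>:box_below \<mu>. box_above \<kappa> - {\<mu>}). g \<mu>')"
  proof (rule sum.reindex_bij_witness[where
        i = "\<lambda>(\<kappa>, \<mu>'). (\<mu> \<union> \<mu>', \<mu>')" and j = "\<lambda>(\<nu>, \<mu>'). (\<mu> \<inter> \<mu>', \<mu>')"])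
    fix a assume "a \<in> (SIGMA \<nu>:box_above \<mu>. box_below \<nu> - {\<mu>})"
    then obtain \<nu> \<mu>' where a: "a = (\<nu>, \<mu>')" "add_box \<mu> \<nu>" "add_box \<mu>' \<nu>" "\<mu>' \<noteq> \<mu>"
      by (auto simp: box_above_def box_below_def)
    with int[OF a(2-4)]
    show "(case case a of (\<nu>, \<mu>') \<Rightarrow> (\<mu> \<inter> \<mu>', \<mu>') of (\<kappa>, \<mu>') \<Rightarrow> (\<mu> \<union> \<mu>', \<mu>')) = a"
      "(case a of (\<nu>, \<mu>') \<Rightarrow> (\<mu> \<inter> \<mu>', \<mu>')) \<in> (SIGMA \<kappa>:box_below \<mu>. box_above \<kappa> - {\<mu>})"
      "(case case a of (\<nu>, \<mu>') \<Rightarrow> (\<mu> \<inter> \<mu>', \<mu>') of (\<kappa>, \<mu>') \<Rightarrow> g \<mu>') = (case a of (\<nu>, \<mu>') \<Rightarrow> g \<mu>')"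
      by (simp_all add: box_above_def box_below_def)
  next
    fix a assume "a \<in> (SIGMA \<kappa>:box_below \<mu>. box_above \<kappa> - {\<mu>})"
    then obtain \<kappa> \<mu>' where a: "a = (\<kappa>, \<mu>')" "add_box \<kappa> \<mu>" "add_box \<kappa> \<mu>'" "\<mu>' \<noteq> \<mu>"
      by (auto simp: box_above_def box_below_def)
    with un[OF a(2-4)]
    show "(case case a of (\<kappa>, \<mu>') \<Rightarrow> (\<mu> \<union> \<mu>', \<mu>') of (\<nu>, \<mu>') \<Rightarrow> (\<mu> \<inter> \<mu>', \<mu>')) = a"
      "(case a of (\<kappa>, \<mu>') \<Rightarrow> (\<mu> \<union> \<mu>', \<mu>')) \<in> (SIGMA \<nu>:box_above \<mu>. box_below \<nu> - {\<mu>})"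
      by (simp_all add: box_above_def box_below_def)
  qed
  also have "\<dots> = (\<Sum>\<kappa>\<in>box_below \<mu>. \<Sum>\<mu>'\<in>box_above \<kappa> - {\<mu>}. g \<mu>')"
    by (rule sum.Sigma[symmetric]) (auto simp: finite_box_above finite_box_below)
  finally show ?thesis .
qed

text \<open>
  Induction on the number of boxes: each term on the left is itself a sum over removed boxes, and the
  commutation relation interchanges adding and removing at the cost of one copy of
  \<open>num_tableaux \<mu>\<close>.
\<close>

lemma sum_box_above:
  assumes "young_diagram \<mu>"
  shows "(\<Sum>\<nu>\<in>box_above \<mu>. num_tableaux \<nu>) = (real (card \<mu>) + 1) * num_tableaux \<mu>"
  using assms
proof (induction "card \<mu>" arbitrary: \<mu> rule: less_induct)
  case less
  let ?f = num_tableaux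
  have below: "young_diagram \<kappa> \<and> Suc (card \<kappa>) = card \<mu>" if "\<kappa> \<in> box_below \<mu>" for \<kappa>
    using that add_box_card[of \<kappa> \<mu>] by (auto simp: box_below_def add_box_def)
  have above: "(\<Sum>\<mu>'\<in>box_below \<nu>. ?f \<mu>') = ?f \<nu>" "\<mu> \<in> box_below \<nu>" if "\<nu> \<in> box_above \<mu>" for \<nu>
    using that sum_box_below[of \<nu>] by (auto simp: box_above_def box_below_def add_box_def)
  have "(\<Sum>\<nu>\<in>box_above \<mu>. ?f \<nu>) = (\<Sum>\<nu>\<in>box_above \<mu>. ?f \<mu> + (\<Sum>\<mu>'\<in>box_below \<nu> - {\<mu>}. ?f \<mu>'))"
    by (intro sum.cong refl)
      (simp add: above(2) finite_box_below flip: above(1) sum.remove)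
  also have "\<dots> = real (card (box_above \<mu>)) * ?f \<mu>
      + (\<Sum>\<kappa>\<in>box_below \<mu>. \<Sum>\<mu>'\<in>box_above \<kappa> - {\<mu>}. ?f \<mu>')"
    by (simp add: sum.distrib exchange_box[OF less.prems])
  also have "\<dots> = ?f \<mu> + (\<Sum>\<kappa>\<in>box_below \<mu>. ?f \<mu> + (\<Sum>\<mu>'\<in>box_above \<kappa> - {\<mu>}. ?f \<mu>'))"
    by (simp add: sum.distrib card_box_above[OF less.prems] algebra_simps)
  also have "\<dots> = ?f \<mu> + (\<Sum>\<kappa>\<in>box_below \<mu>. \<Sum>\<mu>'\<in>box_above \<kappa>. ?f \<mu>')"
    by (intro arg_cong2[where f = "(+)"] sum.cong refl sum.remove[symmetric])
      (simp_all add: finite_box_above mem_box_above_iff)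
  also have "\<dots> = ?f \<mu> + (\<Sum>\<kappa>\<in>box_below \<mu>. real (card \<mu>) * ?f \<kappa>)"
    using less.hyps below by (intro arg_cong2[where f = "(+)"] sum.cong refl) fastforce
  also have "\<dots> = (real (card \<mu>) + 1) * ?f \<mu>"
    using sum_box_below[OF less.prems]
    by (cases "\<mu> = {}") (simp_all add: distrib_right flip: sum_distrib_left)
  finally show ?case .
qed

section \<open>The array K\<close>

lemma same_parity_less:
  fixes a n :: nat
  assumes "a < n" "a mod 2 = n mod 2"
  shows "a + 2 \<le> n"
proof -
  have "n \<noteq> Suc a" using assms(2) by (auto simp: mod_Suc split: if_splits)
  with assms(1) show ?thesis by linarith
qed

lemma K_eq_0:
  assumes "n < 2 * k + l \<or> (2 * k + l) mod 2 \<noteq> n mod 2"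
  shows "K n k l = 0"
proof (cases n)
  case (Suc m)
  with assms have "2 * k + l \<noteq> Suc m" by (metis less_irrefl)
  moreover have "\<not> (2 * k + l < Suc m \<and> (2 * k + l) mod 2 = Suc m mod 2)"
    using assms less_asym[of "2 * k + l" "Suc m"] unfolding Suc by blast
  ultimately show ?thesis unfolding Suc K.simps by (simp only: if_False)
qed (use assms in auto)

lemma K_top: "K (2 * k + l) k l = fact (2 * k + l) / (2 ^ k * fact k * fact l)"
  by (cases "2 * k + l") (auto simp: field_simps)

lemma K_nonneg: "K n k l \<ge> 0"
proof (induction n arbitrary: k l)
  case (Suc n)
  show ?case unfolding K.simps
    by (auto intro!: add_nonneg_nonneg mult_nonneg_nonneg Suc.IH)
qed simp

declare K.simps(2) [simp del]

text \<open>
  With the zero entries outside the index range, the recursion holds without any restriction on the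
  indices; on the diagonal \<open>2k + l = n\<close> it is an identity between the explicit values.  This
  lets sums over neighbours in the coupled graph be taken without a restriction on the level.
\<close>

lemma K_Suc:
  "K (Suc n) k l = (if l = 0 then 0 else K n k (l - 1))
     + (real l + 1) * (K n k (l + 1) + (if k = 0 then 0 else K n (k - 1) (l + 1)))
     + (if l = 0 then 0 else (real k + 1) * K n (k + 1) (l - 1))"
proof -
  consider "2 * k + l = Suc n" | "2 * k + l < Suc n \<and> (2 * k + l) mod 2 = Suc n mod 2"
    | "2 * k + l > Suc n \<or> (2 * k + l) mod 2 \<noteq> Suc n mod 2" by linarith
  then show ?thesis
  proof cases
    case 1
    have far: "K n k (l + 1) = 0" "l > 0 \<Longrightarrow> K n (k + 1) (l - 1) = 0"
      using 1 by (auto intro!: K_eq_0)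
    have "K n k (l - 1) = real l * (fact n / (2 ^ k * fact k * fact l))" if "l > 0"
    proof -
      have n: "n = 2 * k + (l - 1)" using 1 that by simp
      obtain m where "l = Suc m" using \<open>l > 0\<close> by (cases l) auto
      then show ?thesis unfolding n K_top by (simp add: field_simps del: of_nat_Suc)
    qed
    then have a: "(if l = 0 then 0 else K n k (l - 1))
        = real l * (fact n / (2 ^ k * fact k * fact l))" by simp
    have "(real l + 1) * K n (k - 1) (l + 1) = 2 * real k * (fact n / (2 ^ k * fact k * fact l))"
      if "k > 0"
    proof -
      obtain m where m: "k = Suc m" using \<open>k > 0\<close> by (cases k) auto
      have n: "n = 2 * m + (l + 1)" using 1 m by simp
      have f: "fact (l + 1) = (real l + 1) * fact l" "fact k = (real m + 1) * (fact m :: real)"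
        "(2 :: real) ^ k = 2 * 2 ^ m" "real k = real m + 1" "k - 1 = m"
        by (simp_all add: m)
      have *: "a * (F / (p * q * (a * r))) = 2 * b * (F / (2 * p * (b * q) * r))"
        if "a > 0" "b > 0" for a b F p q r :: real
        using that by simp
      have "K n m (l + 1) = fact n / (2 ^ m * fact m * ((real l + 1) * fact l))"
        using K_top[of m "l + 1"] unfolding n[symmetric] f .
      then show ?thesis by (simp only: f) (rule *, simp_all)
    qed
    then have b: "(real l + 1) * (if k = 0 then 0 else K n (k - 1) (l + 1))
        = 2 * real k * (fact n / (2 ^ k * fact k * fact l))" by simp
    have "K (Suc n) k l = real (Suc n) * (fact n / (2 ^ k * fact k * fact l))"
      using K_top[of k l] unfolding 1 by (simp add: field_simps)
    also have "real (Suc n) = real l + 2 * real k" by (simp flip: 1)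
    finally have "K (Suc n) k l
        = real l * (fact n / (2 ^ k * fact k * fact l)) + 2 * real k * (fact n / (2 ^ k * fact k * fact l))"
      by (simp only: distrib_right)
    moreover have "(if l = 0 then 0 else (real k + 1) * K n (k + 1) (l - 1)) = 0" using far by simp
    ultimately show ?thesis by (simp only: a b far distrib_left)
  next
    case 2
    then show ?thesis by (simp add: K.simps)
  next
    case 3
    have 3: "2 * k + l > Suc n \<or> even (2 * k + l) \<noteq> even (Suc n)"
      using 3 by (simp only: mod2_eq_if split: if_splits) auto
    have zero: "K n k' l' = 0"
      if "n < 2 * k' + l' \<or> even (2 * k' + l') \<noteq> even n" for n k' l'
      by (rule K_eq_0) (use that in \<open>auto simp: mod2_eq_if\<close>)
    have "K n k (l + 1) = 0" by (rule zero) (use 3 in auto)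
    moreover have "K n k (l - 1) = 0" if "l > 0" by (rule zero) (use 3 that in auto)
    moreover have "K n (k - 1) (l + 1) = 0" if "k > 0"
    proof (rule zero)
      have "2 * (k - 1) + (l + 1) = 2 * k + l - 1" "even (l + 1) \<noteq> even l" using that by auto
      then show "n < 2 * (k - 1) + (l + 1) \<or> even (2 * (k - 1) + (l + 1)) \<noteq> even n"
        using 3 by auto
    qed
    moreover have "K n (k + 1) (l - 1) = 0" if "l > 0" by (rule zero) (use 3 that in auto)
    moreover have "K (Suc n) k l = 0" by (rule zero) (use 3 in auto)
    ultimately show ?thesis by (cases "l = 0"; cases "k = 0") simp_all
  qed
qed

lemma K_pos: "2 * k + l \<le> n \<Longrightarrow> (2 * k + l) mod 2 = n mod 2 \<Longrightarrow> K n k l > 0"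
proof (induction n arbitrary: k l)
  case (Suc n)
  show ?case
  proof (cases "2 * k + l = Suc n")
    case True
    have "K (2 * k + l) k l > 0" unfolding K_top by simp
    then show ?thesis by (simp only: True)
  next
    case False
    have "2 * k + (l + 1) \<le> n"
      using same_parity_less[of "2 * k + l" "Suc n"] Suc.prems False by linarith
    moreover have "(2 * k + (l + 1)) mod 2 = n mod 2"
      using Suc.prems(2) by (auto simp: mod2_eq_if split: if_splits)
    ultimately have "K n k (l + 1) > 0" by (rule Suc.IH)
    then have "(real l + 1) * K n k (l + 1) > 0" by simp
    moreover have "0 \<le> (if l = 0 then 0 else K n k (l - 1))"
      "0 \<le> (real l + 1) * (if k = 0 then 0 else K n (k - 1) (l + 1))"
      "0 \<le> (if l = 0 then 0 else (real k + 1) * K n (k + 1) (l - 1))"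
      by (simp_all add: K_nonneg)
    ultimately show ?thesis unfolding K_Suc distrib_left by linarith
  qed
qed simp

text \<open>
  A lower bound from a single type of walk: \<open>m\<close> steps that add boxes to the second diagram, followed by
  \<open>j\<close> steps that remove boxes from it.
\<close>

lemma K_ge_fact: "j \<le> m \<Longrightarrow> fact m \<le> K (m + j) 0 (m - j) * fact (m - j)"
proof (induction j)
  case 0
  have "K (2 * 0 + m) 0 m = 1" unfolding K_top by simp
  then show ?case by simp
next
  case (Suc j)
  then obtain i where i: "m - j = Suc i" "m - Suc j = i" by (metis Suc_diff_Suc Suc_le_lessD)
  have "K (m + j) 0 (Suc i) * (real i + 1) \<le> K (m + Suc j) 0 i"
    using K_nonneg[of "m + j" 0 "i - 1"] K_nonneg[of "m + j" 1 "i - 1"]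
    unfolding add_Suc_right K_Suc[of "m + j" 0 i] by (cases "i = 0") (simp_all add: algebra_simps)
  then have "K (m + j) 0 (Suc i) * (real i + 1) * fact i \<le> K (m + Suc j) 0 i * fact i"
    by (rule mult_right_mono) simp
  moreover have "fact m \<le> K (m + j) 0 (Suc i) * fact (Suc i)"
    using Suc i by simp
  ultimately show ?case unfolding i by (simp add: algebra_simps)
qed

text \<open>
  If all these ratios exceeded \<open>\<epsilon>\<close>, then \<open>K (2 * m) 0 0\<close> would grow at most geometrically, but it is at least
  \<open>fact m\<close>.
\<close>

lemma K_ratio_small:
  assumes "\<epsilon> > 0"
  shows "\<exists>m\<ge>1. K (2 * m - 2) 0 0 / K (2 * m) 0 0 \<le> \<epsilon>"
proof (rule ccontr)
  assume "\<not> ?thesis"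
  then have big: "K (2 * m - 2) 0 0 / K (2 * m) 0 0 > \<epsilon>" if "m \<ge> 1" for m
    using that by (meson not_le)
  have "K (2 * m) 0 0 \<le> (1 / \<epsilon>) ^ m" for m
  proof (induction m)
    case (Suc m)
    have "K (2 * Suc m) 0 0 > 0" by (rule K_pos) auto
    then have "K (2 * Suc m) 0 0 \<le> 1 / \<epsilon> * K (2 * m) 0 0"
      using big[of "Suc m"] assms by (simp add: field_simps)
    also have "\<dots> \<le> 1 / \<epsilon> * (1 / \<epsilon>) ^ m"
      using Suc assms by (intro mult_left_mono) auto
    finally show ?case by simp
  qed simp
  \<comment> \<open>The walk returns to the root: the previous bound with as many steps down as up.\<close>
  moreover have "fact m \<le> K (2 * m) 0 0" for m
    using K_ge_fact[of m m] by (simp add: mult_2)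
  ultimately have le: "fact m \<le> (1 / \<epsilon>) ^ m" for m using order_trans by blast
  have "(\<lambda>m. x ^ m / fact m) \<longlonglongrightarrow> 0" for x :: real
    using summable_LIMSEQ_zero[OF summable_exp[of x]] by (simp add: divide_inverse mult.commute)
  then have "eventually (\<lambda>m. (1 / \<epsilon>) ^ m / fact m < 1) sequentially"
    by (rule order_tendstoD) simp
  from eventually_happens'[OF sequentially_bot this]
  obtain m where "(1 / \<epsilon>) ^ m / fact m < 1" ..
  then have "(1 / \<epsilon>) ^ m < fact m" by (simp only: divide_less_eq_1_pos fact_gt_zero)
  with le[of m] show False by simp
qed

text \<open>
  On the diagonal \<open>K n k l\<close> counts the ways to select \<open>k\<close> disjoint pairs from \<open>n\<close> points, and the other entry counts
  those selections in which a prescribed pair occurs.  The ratio is \<open>2 * k / (n * (n - 1))\<close>.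
\<close>

lemma K_ratio_top_le:
  assumes "k > 0" "2 * k + l = n"
  shows "K (n - 2) (k - 1) l \<le> 1 / (real n - 1) * K n k l"
proof -
  obtain i where i: "k = Suc i" using assms by (cases k) auto
  have n: "n = Suc (Suc (2 * i + l))" using assms i by simp
  define c where "c = K (2 * i + l) i l"
  have "c \<ge> 0" by (simp add: c_def K_nonneg)
  have "K n k l = (real n * (real n - 1) / (2 * real k)) * c"
  proof -
    have "K n k l = fact n / (2 ^ k * fact k * fact l)" using K_top[of k l] assms by simp
    also have "\<dots> = (real n * (real n - 1) / (2 * real k)) * (fact (2 * i + l) / (2 ^ i * fact i * fact l))"
      by (simp add: n i field_simps)
    finally show ?thesis by (simp add: c_def K_top)
  qed
  moreover have "K (n - 2) (k - 1) l = c" by (simp add: n i c_def)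
  moreover have "1 / (real n - 1) * (real n * (real n - 1) / (2 * real k)) = real n / (2 * real k)"
  proof -
    have "real n - 1 \<noteq> 0" using n by simp
    then show ?thesis by simp
  qed
  moreover have "c \<le> real n / (2 * real k) * c"
  proof -
    have "1 \<le> real n / (2 * real k)" using assms by (simp add: field_simps)
    from mult_right_mono[OF this \<open>c \<ge> 0\<close>] show ?thesis by (simp only: mult_1_left)
  qed
  ultimately show ?thesis by (simp only: mult.assoc[symmetric])
qed

section \<open>The pascalization of the coupled Young graph\<close>

abbreviation coupled_pascal :: "(nat \<times> diagram \<times> diagram) graded_graph" where
  "coupled_pascal \<equiv> pascalization coupled_young_graph"

lemma mem_level_coupled_pascal:
  "(m, \<nu>, \<mu>) \<in> level coupled_pascal n \<longleftrightarrow>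
    m = n \<and> young_diagram \<nu> \<and> young_diagram \<mu> \<and> 2 * card \<nu> + card \<mu> \<le> n
      \<and> (2 * card \<nu> + card \<mu>) mod 2 = n mod 2"
  by (auto simp: pascalization_def level_coupled_iff)

lemma level_coupled_pascalE:
  assumes "x \<in> level coupled_pascal n"
  obtains \<nu> \<mu> where "x = (n, \<nu>, \<mu>)" "young_diagram \<nu>" "young_diagram \<mu>"
    "2 * card \<nu> + card \<mu> \<le> n" "(2 * card \<nu> + card \<mu>) mod 2 = n mod 2"
  using assms by (cases x) (auto simp: mem_level_coupled_pascal)

lemma finite_level_coupled_pascal: "finite (level coupled_pascal n)"
proof (rule finite_subset)
  show "level coupled_pascal n
      \<subseteq> {n} \<times> ((\<Union>k\<le>n. diagrams k) \<times> (\<Union>k\<le>n. diagrams k))"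
    by (auto elim!: level_coupled_pascalE simp: diagrams_def)
qed (simp add: finite_diagrams)

interpretation pascal: finite_level_graph coupled_pascal
  by unfold_locales
    (rule is_graded_graph_pascalization[OF is_graded_graph_coupled] finite_level_coupled_pascal)+

text \<open>
  The first two parts are the neighbours one level below, the other two those one level above.
\<close>

definition neighbours :: "diagram \<Rightarrow> diagram \<Rightarrow> (diagram \<times> diagram) set" where
  "neighbours \<nu> \<mu> = ({\<nu>} \<times> box_below \<mu> \<union> box_below \<nu> \<times> box_above \<mu>)
     \<union> ({\<nu>} \<times> box_above \<mu> \<union> box_above \<nu> \<times> box_below \<mu>)"

lemma box_belowD:
  assumes "\<kappa> \<in> box_below \<mu>"
  shows "young_diagram \<kappa>" "Suc (card \<kappa>) = card \<mu>"
proof -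
  have "add_box \<kappa> \<mu>" using assms by (simp add: box_below_def)
  then show "young_diagram \<kappa>" "Suc (card \<kappa>) = card \<mu>"
    using add_box_card[of \<kappa> \<mu>] by (simp_all add: add_box_def[of \<kappa> \<mu>])
qed

lemma box_aboveD:
  assumes "\<nu> \<in> box_above \<mu>"
  shows "young_diagram \<nu>" "card \<nu> = Suc (card \<mu>)"
proof -
  have "add_box \<mu> \<nu>" using assms by (simp add: box_above_def)
  then show "young_diagram \<nu>" "card \<nu> = Suc (card \<mu>)"
    using add_box_card[of \<mu> \<nu>] by (simp_all add: add_box_def[of \<mu> \<nu>])
qed

lemma mem_neighbours_iff:
  assumes "young_diagram \<nu>"
  shows "x \<in> neighbours \<nu> \<mu> \<longleftrightarrow>
    adj coupled_young_graph x (\<nu>, \<mu>) \<or> adj coupled_young_graph (\<nu>, \<mu>) x"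
  using assms
  by (cases x) (auto simp: neighbours_def coupled_young_graph_def box_below_def box_above_def add_box_def)

lemma up_coupled_pascal_iff:
  assumes "young_diagram \<nu>"
  shows "up coupled_pascal (m, x) (n, \<nu>, \<mu>) \<longleftrightarrow>
    n = Suc m \<and> (m, x) \<in> level coupled_pascal m \<and> x \<in> neighbours \<nu> \<mu>"
  unfolding pascal.up_iff_adj mem_neighbours_iff[OF assms]
  by (cases x) (auto simp: pascalization_def)

lemma neighbours_young:
  assumes "young_diagram \<nu>" "young_diagram \<mu>" "(\<nu>', \<mu>') \<in> neighbours \<nu> \<mu>"
  shows "young_diagram \<nu>' \<and> young_diagram \<mu>' \<and>
    (2 * card \<nu>' + card \<mu>' = Suc (2 * card \<nu> + card \<mu>)
      \<or> Suc (2 * card \<nu>' + card \<mu>') = 2 * card \<nu> + card \<mu>)"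
proof -
  consider "\<nu>' = \<nu>" "\<mu>' \<in> box_below \<mu>" | "\<nu>' \<in> box_below \<nu>" "\<mu>' \<in> box_above \<mu>"
    | "\<nu>' = \<nu>" "\<mu>' \<in> box_above \<mu>" | "\<nu>' \<in> box_above \<nu>" "\<mu>' \<in> box_below \<mu>"
    using assms(3) unfolding neighbours_def by blast
  then show ?thesis
  proof cases
    case 1
    then show ?thesis using box_belowD[OF 1(2)] assms(1) by simp
  next
    case 2
    then show ?thesis using box_belowD[OF 2(1)] box_aboveD[OF 2(2)] by linarith
  next
    case 3
    then show ?thesis using box_aboveD[OF 3(2)] assms(1) by simp
  next
    case 4
    then show ?thesis using box_aboveD[OF 4(1)] box_belowD[OF 4(2)] by linarith
  qed
qed

lemma preds_coupled_pascal:
  assumes "(Suc n, \<nu>, \<mu>) \<in> level coupled_pascal (Suc n)"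
  shows "pascal.preds (Suc n, \<nu>, \<mu>)
    = Pair n ` {(\<nu>', \<mu>') \<in> neighbours \<nu> \<mu>. 2 * card \<nu>' + card \<mu>' \<le> n}"
proof -
  have y: "young_diagram \<nu>" "young_diagram \<mu>" "(2 * card \<nu> + card \<mu>) mod 2 = Suc n mod 2"
    using assms by (auto simp: mem_level_coupled_pascal)
  have parity: "(2 * card \<nu>' + card \<mu>') mod 2 = n mod 2" if "(\<nu>', \<mu>') \<in> neighbours \<nu> \<mu>" for \<nu>' \<mu>'
  proof -
    have "a mod 2 = n mod 2" if "a = Suc b \<or> Suc a = b" "b mod 2 = Suc n mod 2" for a b
      using that by (auto simp: mod2_eq_if split: if_splits)
    then show ?thesis using neighbours_young[OF y(1,2) that] y(3) by blast
  qed
  have "x \<in> pascal.preds (Suc n, \<nu>, \<mu>) \<longleftrightarrow>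
      x \<in> Pair n ` {(\<nu>', \<mu>') \<in> neighbours \<nu> \<mu>. 2 * card \<nu>' + card \<mu>' \<le> n}" for x
  proof (cases x)
    case (fields m \<nu>' \<mu>')
    have "x \<in> pascal.preds (Suc n, \<nu>, \<mu>) \<longleftrightarrow>
        m = n \<and> (n, \<nu>', \<mu>') \<in> level coupled_pascal n \<and> (\<nu>', \<mu>') \<in> neighbours \<nu> \<mu>"
      unfolding fields pascal.preds_def mem_Collect_eq up_coupled_pascal_iff[OF y(1)] by blast
    moreover have "(n, \<nu>', \<mu>') \<in> level coupled_pascal n \<longleftrightarrow> 2 * card \<nu>' + card \<mu>' \<le> n"
      if "(\<nu>', \<mu>') \<in> neighbours \<nu> \<mu>"
      using parity[OF that] neighbours_young[OF y(1,2) that] unfolding mem_level_coupled_pascal by blast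
    moreover have "x \<in> Pair n ` {(\<nu>', \<mu>') \<in> neighbours \<nu> \<mu>. 2 * card \<nu>' + card \<mu>' \<le> n} \<longleftrightarrow>
        m = n \<and> (\<nu>', \<mu>') \<in> neighbours \<nu> \<mu> \<and> 2 * card \<nu>' + card \<mu>' \<le> n"
      unfolding fields by auto
    ultimately show ?thesis by blast
  qed
  then show ?thesis by blast
qed

text \<open>
  All path counts that occur here have this form: an array indexed by the numbers of boxes times the
  numbers of standard tableaux of the two diagrams.
\<close>

definition tableaux_weight :: "(nat \<Rightarrow> nat \<Rightarrow> real) \<Rightarrow> diagram \<times> diagram \<Rightarrow> real" where
  "tableaux_weight c = (\<lambda>(\<nu>, \<mu>). c (card \<nu>) (card \<mu>) * (num_tableaux \<nu> * num_tableaux \<mu>))"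

text \<open>
  The right-hand side of the recursion for \<open>K\<close> as an operator on arrays.
\<close>

definition K_step :: "(nat \<Rightarrow> nat \<Rightarrow> real) \<Rightarrow> nat \<Rightarrow> nat \<Rightarrow> real" where
  "K_step c k l = (if l = 0 then 0 else c k (l - 1))
     + (real l + 1) * (c k (l + 1) + (if k = 0 then 0 else c (k - 1) (l + 1)))
     + (if l = 0 then 0 else (real k + 1) * c (k + 1) (l - 1))"

lemma K_Suc_step: "K (Suc n) = K_step (K n)"
  by (intro ext) (simp add: K_Suc K_step_def)

lemma sum_tableaux_weight_Times:
  assumes "\<And>\<nu>. \<nu> \<in> X \<Longrightarrow> card \<nu> = k" "\<And>\<mu>. \<mu> \<in> Y \<Longrightarrow> card \<mu> = l"
  shows "(\<Sum>x\<in>X \<times> Y. tableaux_weight c x)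
    = c k l * ((\<Sum>\<nu>\<in>X. num_tableaux \<nu>) * (\<Sum>\<mu>\<in>Y. num_tableaux \<mu>))"
proof -
  have "(\<Sum>x\<in>X \<times> Y. tableaux_weight c x)
      = (\<Sum>(\<nu>, \<mu>)\<in>X \<times> Y. c k l * (num_tableaux \<nu> * num_tableaux \<mu>))"
    using assms by (intro sum.cong refl) (auto simp: tableaux_weight_def)
  also have "\<dots> = c k l * (\<Sum>(\<nu>, \<mu>)\<in>X \<times> Y. num_tableaux \<nu> * num_tableaux \<mu>)"
    by (simp add: sum_distrib_left case_prod_beta)
  finally show ?thesis by (simp add: sum_product sum.cartesian_product)
qed

lemma finite_neighbours: "finite (neighbours \<nu> \<mu>)"
  by (simp add: neighbours_def finite_box_above finite_box_below)

text \<open>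
  The four types of neighbours produce the four terms of the recursion for \<open>K\<close>: the numbers of tableaux
  of the diagrams with one box less than \<open>\<mu>\<close> add up to that of \<open>\<mu>\<close>, those of the diagrams with one box more to \<open>l + 1\<close>
  times that of \<open>\<mu>\<close>, where \<open>l\<close> is the size of \<open>\<mu>\<close>.
\<close>

lemma sum_neighbours:
  assumes "young_diagram \<nu>" "young_diagram \<mu>"
  shows "(\<Sum>x\<in>neighbours \<nu> \<mu>. tableaux_weight c x) = tableaux_weight (K_step c) (\<nu>, \<mu>)"
proof -
  let ?w = "tableaux_weight c" and ?f = num_tableaux and ?k = "card \<nu>" and ?l = "card \<mu>"
  have below: "(\<Sum>\<kappa>\<in>box_below \<nu>. ?f \<kappa>) = (if card \<nu> = 0 then 0 else ?f \<nu>)" if "young_diagram \<nu>" for \<nu>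
    using sum_box_below[OF that] that by (auto simp: young_diagram_def)
  have disj: "box_below \<nu> \<inter> box_above \<nu> = {}" "\<nu> \<notin> box_below \<nu>" "\<nu> \<notin> box_above \<nu>" for \<nu>
  proof -
    have False if "\<kappa> \<in> box_below \<nu>" "\<kappa> \<in> box_above \<nu>" for \<kappa>
      using box_belowD(2)[OF that(1)] box_aboveD(2)[OF that(2)] by simp
    then show "box_below \<nu> \<inter> box_above \<nu> = {}" by blast
    show "\<nu> \<notin> box_below \<nu>" "\<nu> \<notin> box_above \<nu>"
      using box_belowD(2)[of \<nu> \<nu>] box_aboveD(2)[of \<nu> \<nu>] by auto
  qed
  let ?A = "{\<nu>} \<times> box_below \<mu>" and ?B = "box_below \<nu> \<times> box_above \<mu>"
  let ?C = "{\<nu>} \<times> box_above \<mu>" and ?D = "box_above \<nu> \<times> box_below \<mu>"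
  have fin: "finite ?A" "finite ?B" "finite ?C" "finite ?D"
    by (simp_all add: finite_box_above finite_box_below)
  have int: "?A \<inter> ?B = {}" "?C \<inter> ?D = {}" "(?A \<union> ?B) \<inter> (?C \<union> ?D) = {}"
    using disj[of \<nu>] disj[of \<mu>] by auto
  have "(\<Sum>x\<in>neighbours \<nu> \<mu>. ?w x)
      = ((\<Sum>x\<in>?A. ?w x) + (\<Sum>x\<in>?B. ?w x)) + ((\<Sum>x\<in>?C. ?w x) + (\<Sum>x\<in>?D. ?w x))"
    unfolding neighbours_def by (simp only: sum.union_disjoint finite_UnI fin int)
  also have "(\<Sum>x\<in>?A. ?w x)
      = c ?k (?l - 1) * (?f \<nu> * (if ?l = 0 then 0 else ?f \<mu>))"
    by (subst sum_tableaux_weight_Times[where k = ?k and l = "?l - 1"])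
      (auto simp: below assms dest: box_belowD)
  also have "(\<Sum>x\<in>?B. ?w x)
      = c (?k - 1) (?l + 1) * ((if ?k = 0 then 0 else ?f \<nu>) * ((real ?l + 1) * ?f \<mu>))"
    by (subst sum_tableaux_weight_Times[where k = "?k - 1" and l = "?l + 1"])
      (auto simp: below sum_box_above assms dest: box_belowD box_aboveD)
  also have "(\<Sum>x\<in>?C. ?w x) = c ?k (?l + 1) * (?f \<nu> * ((real ?l + 1) * ?f \<mu>))"
    by (subst sum_tableaux_weight_Times[where k = ?k and l = "?l + 1"])
      (auto simp: sum_box_above assms dest: box_aboveD)
  also have "(\<Sum>x\<in>?D. ?w x)
      = c (?k + 1) (?l - 1) * (((real ?k + 1) * ?f \<nu>) * (if ?l = 0 then 0 else ?f \<mu>))"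
    by (subst sum_tableaux_weight_Times[where k = "?k + 1" and l = "?l - 1"])
      (auto simp: below sum_box_above assms dest: box_belowD box_aboveD)
  finally show ?thesis
    by (simp add: tableaux_weight_def K_step_def algebra_simps)
qed

text \<open>
  The predecessors are the neighbours of size at most \<open>n\<close>; on the others the array vanishes.
\<close>

lemma sum_preds_tableaux_weight:
  assumes y: "(Suc n, \<nu>, \<mu>) \<in> level coupled_pascal (Suc n)"
    and c: "\<And>k l. n < 2 * k + l \<Longrightarrow> c k l = 0"
  shows "(\<Sum>x\<in>pascal.preds (Suc n, \<nu>, \<mu>). tableaux_weight c (snd x))
    = tableaux_weight (K_step c) (\<nu>, \<mu>)"
proof -
  have "(\<Sum>x\<in>pascal.preds (Suc n, \<nu>, \<mu>). tableaux_weight c (snd x))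
      = (\<Sum>x\<in>{(\<nu>', \<mu>') \<in> neighbours \<nu> \<mu>. 2 * card \<nu>' + card \<mu>' \<le> n}. tableaux_weight c x)"
    unfolding preds_coupled_pascal[OF y] by (subst sum.reindex) (auto simp: inj_on_def)
  also have "\<dots> = (\<Sum>x\<in>neighbours \<nu> \<mu>. tableaux_weight c x)"
  proof (rule sum.mono_neutral_left)
    have "2 * k + l \<le> n" if "c k l \<noteq> 0" for k l using c that by (meson not_le)
    then show "\<forall>x\<in>neighbours \<nu> \<mu> - {(\<nu>', \<mu>') \<in> neighbours \<nu> \<mu>. 2 * card \<nu>' + card \<mu>' \<le> n}.
        tableaux_weight c x = 0"
      by (auto simp: tableaux_weight_def)
  qed (auto simp: finite_neighbours)
  finally show ?thesis
    using y by (simp add: sum_neighbours mem_level_coupled_pascal)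
qed

lemma dim_path_coupled_pascal:
  "(n, \<nu>, \<mu>) \<in> level coupled_pascal n \<Longrightarrow>
    real (dim_path coupled_pascal (n, \<nu>, \<mu>)) = tableaux_weight (K n) (\<nu>, \<mu>)"
proof (induction n arbitrary: \<nu> \<mu>)
  case 0
  have "root coupled_pascal = (0, {}, {})" by (simp add: pascalization_def coupled_young_graph_def)
  with 0 have "(0, \<nu>, \<mu>) = root coupled_pascal" by (simp add: pascal.level_0)
  with \<open>root coupled_pascal = (0, {}, {})\<close> show ?case
    using pascal.dim_path_root by (simp add: tableaux_weight_def)
next
  case (Suc n)
  have "real (dim_path coupled_pascal (Suc n, \<nu>, \<mu>))
      = (\<Sum>x\<in>pascal.preds (Suc n, \<nu>, \<mu>). real (dim_path coupled_pascal x))"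
    using pascal.dim_path_Suc[OF Suc.prems] by simp
  also have "\<dots> = (\<Sum>x\<in>pascal.preds (Suc n, \<nu>, \<mu>). tableaux_weight (K n) (snd x))"
  proof (intro sum.cong refl)
    fix x assume "x \<in> pascal.preds (Suc n, \<nu>, \<mu>)"
    then have "x \<in> level coupled_pascal n" using pascal.preds_subset[OF Suc.prems] by blast
    then show "real (dim_path coupled_pascal x) = tableaux_weight (K n) (snd x)"
      using Suc.IH by (cases x) (auto simp: mem_level_coupled_pascal)
  qed
  also have "\<dots> = tableaux_weight (K (Suc n)) (\<nu>, \<mu>)"
    unfolding K_Suc_step by (rule sum_preds_tableaux_weight[OF Suc.prems]) (simp add: K_eq_0)
  finally show ?case .
qed

lemma tableaux_weight_le:
  assumes "c (card \<nu>) (card \<mu>) \<le> \<epsilon> * c' (card \<nu>) (card \<mu>)"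
  shows "tableaux_weight c (\<nu>, \<mu>) \<le> \<epsilon> * tableaux_weight c' (\<nu>, \<mu>)"
proof -
  have "0 \<le> num_tableaux \<nu> * num_tableaux \<mu>" by (simp add: num_tableaux_def)
  from mult_right_mono[OF assms this] show ?thesis
    by (simp only: tableaux_weight_def prod.case mult.assoc)
qed

text \<open>
  Lowering \<open>k\<close> by 1 or \<open>l\<close> by 2 does not decrease the ratio, and these moves end at \<open>(0, delta n)\<close>.
\<close>

lemma K_ratio_le:
  assumes K_mono:
    "\<And>n k l. n \<ge> 3 \<Longrightarrow> 2 * k + l < n - 2 \<Longrightarrow> (2 * k + l) mod 2 = n mod 2 \<Longrightarrow>
       K (n - 2) k l / K n k l \<ge>
         max (K (n - 2) (k + 1) l / K n (k + 1) l) (K (n - 2) k (l + 2) / K n k (l + 2))"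
    and n: "2 * k + l < n" "(2 * k + l) mod 2 = n mod 2"
  shows "K (n - 2) k l / K n k l \<le> K (n - 2) 0 (delta n) / K n 0 (delta n)"
  using n
proof (induction "2 * k + l" arbitrary: k l rule: less_induct)
  case less
  note gap = same_parity_less[OF less.prems]
  consider "k > 0" | "l \<ge> 2" | "k = 0" "l = 0 \<or> l = 1" by linarith
  then show ?case
  proof cases
    case 1
    then obtain k' where k': "k = Suc k'" by (auto dest: gr0_implies_Suc)
    have par: "(2 * k' + l) mod 2 = n mod 2" using less.prems(2) k' by simp
    moreover have "2 * k' + l < n - 2" "n \<ge> 3" using gap k' by linarith+
    ultimately have "K (n - 2) k l / K n k l \<le> K (n - 2) k' l / K n k' l"
      using K_mono[of n k' l] k' by simp
    also have "\<dots> \<le> K (n - 2) 0 (delta n) / K n 0 (delta n)"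
      using less.prems k' par by (intro less.hyps) auto
    finally show ?thesis .
  next
    case 2
    then obtain l' where l': "l = Suc (Suc l')" by (metis add_2_eq_Suc le_Suc_ex)
    have par: "(2 * k + l') mod 2 = n mod 2" using less.prems(2) l' by simp
    moreover have "2 * k + l' < n - 2" "n \<ge> 3" using gap l' by linarith+
    ultimately have "K (n - 2) k l / K n k l \<le> K (n - 2) k l' / K n k l'"
      using K_mono[of n k l'] l' by simp
    also have "\<dots> \<le> K (n - 2) 0 (delta n) / K n 0 (delta n)"
      using less.prems l' par by (intro less.hyps) auto
    finally show ?thesis .
  next
    case 3
    then have "l = delta n" using less.prems by (auto simp: delta_def even_iff_mod_2_eq_zero)
    with 3 show ?thesis by simp
  qed
qed

lemma reachable_coupled_pascal:
  assumes "x \<in> level coupled_pascal n"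
  shows "dim_path coupled_pascal x > 0"
proof -
  obtain \<nu> \<mu> where x: "x = (n, \<nu>, \<mu>)" "young_diagram \<nu>" "young_diagram \<mu>"
    "2 * card \<nu> + card \<mu> \<le> n" "(2 * card \<nu> + card \<mu>) mod 2 = n mod 2"
    using assms by (rule level_coupled_pascalE)
  have "tableaux_weight (K n) (\<nu>, \<mu>) > 0"
    using x K_pos num_tableaux_pos by (simp add: tableaux_weight_def)
  then show ?thesis
    using dim_path_coupled_pascal assms unfolding x(1) by (metis of_nat_0_less_iff)
qed

locale coupled_central_measure = central_measure_on coupled_pascal M for M

lemma coupled_central_measureI:
  "central_measure coupled_pascal M \<Longrightarrow> coupled_central_measure M"
  by unfold_locales (assumption | erule reachable_coupled_pascal)+

context coupled_central_measure
begin

text \<open>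
  The path counts from the vertex \<open>(2, ({}, {}))\<close> are those from the root with the level shifted by 2, so
  the fraction of paths through this vertex among all paths to a vertex of level \<open>N\<close> is
  \<open>K (N - 2) k l / K N k l\<close>.  By assumption it is at most its value at \<open>(0, delta N)\<close>,
  which is arbitrarily small for suitable even \<open>N\<close>.
\<close>

lemma weight_return_eq_0:
  assumes ratio: "\<And>n k l. 2 * k + l < n \<Longrightarrow> (2 * k + l) mod 2 = n mod 2 \<Longrightarrow>
      K (n - 2) k l / K n k l \<le> K (n - 2) 0 (delta n) / K n 0 (delta n)"
  shows "weight 2 (2, {}, {}) = 0"
proof (rule weight_eq_0[where W = "\<lambda>n x. tableaux_weight (K (n - 2)) (snd x)"])
  fix n y assume n: "2 \<le> n" and "y \<in> level coupled_pascal (Suc n)"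
  then obtain \<nu> \<mu> where y: "y = (Suc n, \<nu>, \<mu>)" "(Suc n, \<nu>, \<mu>) \<in> level coupled_pascal (Suc n)"
    by (metis level_coupled_pascalE)
  have "(\<Sum>x\<in>preds (Suc n, \<nu>, \<mu>). tableaux_weight (K (n - 2)) (snd x))
      = tableaux_weight (K_step (K (n - 2))) (\<nu>, \<mu>)"
    by (rule sum_preds_tableaux_weight[OF y(2)]) (rule K_eq_0, linarith)
  moreover have "Suc n - 2 = Suc (n - 2)" using n by simp
  ultimately show "tableaux_weight (K (Suc n - 2)) (snd y)
      = (\<Sum>x\<in>preds y. tableaux_weight (K (n - 2)) (snd x))"
    by (simp only: y(1) snd_conv K_Suc_step)
next
  show "tableaux_weight (K (2 - 2)) (snd x) \<ge> 0" for x :: "nat \<times> diagram \<times> diagram"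
    using K_nonneg by (cases x) (simp add: tableaux_weight_def num_tableaux_def)
next
  show "(2, {}, {}) \<in> level coupled_pascal 2" by (simp add: mem_level_coupled_pascal)
  show "0 < tableaux_weight (K (2 - 2)) (snd (2 :: nat, {}, {}))" by (simp add: tableaux_weight_def)
next
  fix \<epsilon> :: real assume "\<epsilon> > 0"
  then obtain m where m: "m \<ge> 1" "K (2 * m - 2) 0 0 / K (2 * m) 0 0 \<le> \<epsilon>"
    using K_ratio_small by blast
  show "\<exists>N\<ge>2. \<forall>y\<in>level coupled_pascal N. weight N y \<noteq> 0 \<longrightarrow>
      tableaux_weight (K (N - 2)) (snd y) \<le> \<epsilon> * real (dim_path coupled_pascal y)"
  proof (intro exI conjI ballI impI)
    show "2 \<le> 2 * m" using m by simp
    fix y assume y': "y \<in> level coupled_pascal (2 * m)"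
    then obtain \<nu> \<mu> where y: "y = (2 * m, \<nu>, \<mu>)" "young_diagram \<nu>" "young_diagram \<mu>"
      "2 * card \<nu> + card \<mu> \<le> 2 * m" "(2 * card \<nu> + card \<mu>) mod 2 = (2 * m) mod 2"
      by (rule level_coupled_pascalE)
    let ?k = "card \<nu>" and ?l = "card \<mu>"
    have pos: "K (2 * m) ?k ?l > 0" using y by (intro K_pos)
    have "K (2 * m - 2) ?k ?l \<le> \<epsilon> * K (2 * m) ?k ?l"
    proof (cases "2 * ?k + ?l = 2 * m")
      case True
      then have "K (2 * m - 2) ?k ?l = 0" using m(1) by (intro K_eq_0) simp
      with pos \<open>\<epsilon> > 0\<close> show ?thesis by simp
    next
      case False
      then have "K (2 * m - 2) ?k ?l / K (2 * m) ?k ?l \<le> K (2 * m - 2) 0 0 / K (2 * m) 0 0"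
        using ratio[of ?k ?l "2 * m"] y by (simp add: delta_def)
      also have "\<dots> \<le> \<epsilon>" by (rule m(2))
      finally show ?thesis using pos by (simp add: pos_divide_le_eq)
    qed
    then show "tableaux_weight (K (2 * m - 2)) (snd y) \<le> \<epsilon> * real (dim_path coupled_pascal y)"
      using tableaux_weight_le y' dim_path_coupled_pascal y(1) by auto
  qed
qed

text \<open>
  A walk from the root to \<open>x\<close> can also be started at \<open>(2, ({}, {}))\<close>, so every vertex
  outside the coupled graph is reachable from this vertex.
\<close>

lemma weight_off_coupled_eq_0:
  assumes return: "weight 2 (2, {}, {}) = 0"
    and "(n, x) \<in> level coupled_pascal n"
  shows "weight (n + 2) (n + 2, x) = 0"
  using assms(2)
proof (induction n arbitrary: x)
  case 0
  then have "x = ({}, {})"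
    by (cases x) (auto simp: mem_level_coupled_pascal young_diagram_def)
  with return show ?case by (simp add: numeral_2_eq_2)
next
  case (Suc n)
  obtain \<nu> \<mu> where x: "x = (\<nu>, \<mu>)" by fastforce
  have "preds (Suc n, x) \<noteq> {}"
  proof
    assume "preds (Suc n, x) = {}"
    then show False using dim_path_Suc[OF Suc.prems] reachable[OF Suc.prems] by simp
  qed
  then obtain m z where "up coupled_pascal (m, z) (Suc n, \<nu>, \<mu>)"
    unfolding preds_def x by auto
  moreover have young: "young_diagram \<nu>" using Suc.prems x by (simp add: mem_level_coupled_pascal)
  ultimately have z: "(n, z) \<in> level coupled_pascal n" "z \<in> neighbours \<nu> \<mu>"
    by (auto simp: up_coupled_pascal_iff)
  then have z2: "(n + 2, z) \<in> level coupled_pascal (n + 2)"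
    by (cases z) (auto simp: mem_level_coupled_pascal)
  with z young have "up coupled_pascal (n + 2, z) (Suc (n + 2), x)"
    by (simp add: up_coupled_pascal_iff x)
  from weight_antimono[OF z2 this] Suc.IH[OF z(1)] weight_nonneg[of "Suc (n + 2)" "(Suc (n + 2), x)"]
  show ?case by simp
qed

lemma young_diagram_box [simp]: "young_diagram {(0, 0)}"
  by (rule young_diagramI) auto

text \<open>
  Up to the numbers of tableaux, the paths in the coupled graph from \<open>(2, ({(0, 0)}, {}))\<close> to a vertex of
  level \<open>n\<close> are as many as the selections of disjoint pairs from \<open>n\<close> points that contain one prescribed pair, a fraction
  of at most \<open>1 / (n - 1)\<close> of all selections.  The array \<open>c\<close> counts them; it is supported on the diagonal, and it satisfies
  the recursion only for vertices of the coupled graph, where the weight may be nonzero.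
\<close>

lemma weight_first_pairing_eq_0:
  assumes coupled: "\<And>n \<nu> \<mu>. (n, \<nu>, \<mu>) \<in> level coupled_pascal n \<Longrightarrow> 2 * card \<nu> + card \<mu> \<noteq> n \<Longrightarrow>
      weight n (n, \<nu>, \<mu>) = 0"
  shows "weight 2 (2, {(0, 0)}, {}) = 0"
proof -
  define c where "c n k l = (if k = 0 \<or> 2 * k + l \<noteq> n then 0 else K (n - 2) (k - 1) l)" for n k l
  show ?thesis
  proof (rule weight_eq_0[where W = "\<lambda>n x. tableaux_weight (c n) (snd x)"])
    fix n y assume n: "2 \<le> n" and y': "y \<in> level coupled_pascal (Suc n)" "weight (Suc n) y \<noteq> 0"
    then obtain \<nu> \<mu> where y: "y = (Suc n, \<nu>, \<mu>)" "(Suc n, \<nu>, \<mu>) \<in> level coupled_pascal (Suc n)"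
      by (metis level_coupled_pascalE)
    have size: "2 * card \<nu> + card \<mu> = Suc n" using coupled y y' by blast
    have "(\<Sum>x\<in>preds (Suc n, \<nu>, \<mu>). tableaux_weight (c n) (snd x)) = tableaux_weight (K_step (c n)) (\<nu>, \<mu>)"
      by (rule sum_preds_tableaux_weight[OF y(2)]) (simp add: c_def)
    moreover have "K_step (c n) k l = c (Suc n) k l" if kl: "2 * k + l = Suc n" for k l
    proof (cases k)
      case 0
      then show ?thesis using kl by (simp add: K_step_def c_def)
    next
      case (Suc i)
      obtain j where j: "n = Suc (Suc j)" using le_Suc_ex[OF n] by auto
      have size: "2 * i + l = Suc j" using kl Suc j by simp
      have "c (Suc n) k l = K (Suc j) i l" "c n k (l + 1) = 0"
        unfolding c_def Suc j using size by simp_all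
      moreover have "c n k (l - 1) = K j i (l - 1)" "c n (k + 1) (l - 1) = 0" if "l > 0"
        unfolding c_def Suc j using size that by simp_all
      moreover have "c n (k - 1) (l + 1) = (if i = 0 then 0 else K j (i - 1) (l + 1))"
        unfolding c_def Suc j using size by simp
      moreover have "K j i (l + 1) = 0" by (rule K_eq_0) (use size in simp)
      moreover have "K j (i + 1) (l - 1) = 0" if "l > 0" by (rule K_eq_0) (use size that in simp)
      ultimately show ?thesis
        unfolding K_step_def by (cases "l = 0") (simp_all add: K_Suc Suc)
    qed
    ultimately show "tableaux_weight (c (Suc n)) (snd y) = (\<Sum>x\<in>preds y. tableaux_weight (c n) (snd x))"
      by (simp add: y tableaux_weight_def size)
  next
    show "tableaux_weight (c 2) (snd x) \<ge> 0" for x :: "nat \<times> diagram \<times> diagram"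
      using K_nonneg by (cases x) (simp add: tableaux_weight_def num_tableaux_def c_def)
  next
    show "(2, {(0, 0)}, {}) \<in> level coupled_pascal 2" by (simp add: mem_level_coupled_pascal)
    show "0 < tableaux_weight (c 2) (snd (2 :: nat, {(0, 0)}, {}))"
      using num_tableaux_pos[OF young_diagram_box] by (simp add: tableaux_weight_def c_def)
  next
    fix \<epsilon> :: real assume "\<epsilon> > 0"
    obtain m :: nat where m: "1 / \<epsilon> < real m" using reals_Archimedean2 by blast
    have "real m > 0" using m \<open>\<epsilon> > 0\<close> by (meson divide_pos_pos less_trans zero_less_one)
    show "\<exists>N\<ge>2. \<forall>y\<in>level coupled_pascal N. weight N y \<noteq> 0 \<longrightarrow>
        tableaux_weight (c N) (snd y) \<le> \<epsilon> * real (dim_path coupled_pascal y)"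
    proof (intro exI conjI ballI impI)
      show "2 \<le> Suc m" using \<open>real m > 0\<close> by simp
      fix y assume y': "y \<in> level coupled_pascal (Suc m)"
      then obtain \<nu> \<mu> where y: "y = (Suc m, \<nu>, \<mu>)" "young_diagram \<nu>" "young_diagram \<mu>"
        by (rule level_coupled_pascalE)
      let ?k = "card \<nu>" and ?l = "card \<mu>"
      have "1 / real m \<le> \<epsilon>" using m \<open>\<epsilon> > 0\<close> \<open>real m > 0\<close> by (simp add: field_simps)
      then have "1 / real m * K (Suc m) ?k ?l \<le> \<epsilon> * K (Suc m) ?k ?l"
        by (rule mult_right_mono) (rule K_nonneg)
      moreover have "c (Suc m) ?k ?l \<le> 1 / real m * K (Suc m) ?k ?l"
        using K_ratio_top_le[of ?k ?l "Suc m"] K_nonneg[of "Suc m" ?k ?l] by (auto simp: c_def)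
      ultimately have "c (Suc m) ?k ?l \<le> \<epsilon> * K (Suc m) ?k ?l" by (rule order_trans[rotated])
      then show "tableaux_weight (c (Suc m)) (snd y) \<le> \<epsilon> * real (dim_path coupled_pascal y)"
        using tableaux_weight_le y' dim_path_coupled_pascal y(1) by auto
    qed
  qed
qed

text \<open>
  In the coupled graph, every vertex with nonempty first diagram is reachable from the vertex whose first diagram is
  the single box: build the first diagram box by box, using the second one as an
  intermediate stop, and then build the second one.
\<close>

lemma weight_coupled_eq_0:
  assumes pairing: "weight 2 (2, {(0, 0)}, {}) = 0"
    and "young_diagram \<nu>" "young_diagram \<mu>" "\<nu> \<noteq> {}" "n = 2 * card \<nu> + card \<mu>"
  shows "weight n (n, \<nu>, \<mu>) = 0"
  using assms(2-)
proof (induction n arbitrary: \<nu> \<mu>)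
  case 0
  then show ?case by (simp add: young_diagram_def)
next
  case (Suc n)
  have step: "weight (Suc n) (Suc n, \<nu>, \<mu>) = 0"
    if "(\<nu>', \<mu>') \<in> neighbours \<nu> \<mu>" "young_diagram \<nu>'" "young_diagram \<mu>'" "\<nu>' \<noteq> {}"
      "n = 2 * card \<nu>' + card \<mu>'" for \<nu>' \<mu>'
  proof -
    have lev: "(n, \<nu>', \<mu>') \<in> level coupled_pascal n" using that by (simp add: mem_level_coupled_pascal)
    moreover have "up coupled_pascal (n, \<nu>', \<mu>') (Suc n, \<nu>, \<mu>)"
      using lev that Suc.prems by (simp add: up_coupled_pascal_iff)
    ultimately show ?thesis
      using weight_antimono Suc.IH[OF that(2-5)] weight_nonneg by (metis order_antisym)
  qed
  show ?case
  proof (cases "\<mu> = {}")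
    case False
    then obtain \<kappa> where \<kappa>: "\<kappa> \<in> box_below \<mu>" using box_below_nonempty Suc.prems by blast
    show ?thesis
      using box_belowD[OF \<kappa>] \<kappa> Suc.prems by (intro step[of \<nu> \<kappa>]) (auto simp: neighbours_def)
  next
    case True
    obtain \<kappa> where \<kappa>: "\<kappa> \<in> box_below \<nu>" using box_below_nonempty Suc.prems by blast
    show ?thesis
    proof (cases "\<kappa> = {}")
      case True
      obtain b where b: "\<nu> = {b}" using \<kappa> True by (auto simp: box_below_def add_box_def)
      have "(0, 0) \<in> \<nu>" using young_diagramD[OF Suc.prems(1), of "fst b" "snd b"] b by auto
      with b have "\<nu> = {(0, 0)}" by auto
      with \<open>\<mu> = {}\<close> Suc.prems pairing show ?thesis by (simp add: numeral_2_eq_2)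
    next
      case False
      have "{(0, 0)} \<in> box_above {}"
        unfolding box_above_def by (auto intro: add_boxI)
      then show ?thesis
        using \<open>\<mu> = {}\<close> box_belowD[OF \<kappa>] \<kappa> Suc.prems False
        by (intro step[of \<kappa> "{(0, 0)}"]) (auto simp: neighbours_def)
    qed
  qed
qed

end

section \<open>The support of a central measure\<close>

theorem corollary5p11:
  assumes K_mono:
    "\<And>n k l. n \<ge> 3 \<Longrightarrow> 2 * k + l < n - 2 \<Longrightarrow> (2 * k + l) mod 2 = n mod 2 \<Longrightarrow>
       K (n - 2) k l / K n k l \<ge>
         max (K (n - 2) (k + 1) l / K n (k + 1) l) (K (n - 2) k (l + 2) / K n k (l + 2))"
  shows
    "(\<forall>n \<ge> 2. Max {K (n - 2) k l / K n k l | k l. 2 * k + l < n \<and> (2 * k + l) mod 2 = n mod 2} =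
        K (n - 2) 0 (delta n) / K n 0 (delta n)) \<and>
     (\<forall>M. central_measure (pascalization coupled_young_graph) M \<longrightarrow>
        fully_supported_on M (in_pascalization coupled_young_graph) \<and>
        fully_supported_on M young_in_pascalization)"
proof (intro conjI allI impI)
  fix n :: nat assume n: "n \<ge> 2"
  let ?R = "{K (n - 2) k l / K n k l | k l. 2 * k + l < n \<and> (2 * k + l) mod 2 = n mod 2}"
  show "Max ?R = K (n - 2) 0 (delta n) / K n 0 (delta n)"
  proof (rule Max_eqI)
    have "?R \<subseteq> (\<lambda>(k, l). K (n - 2) k l / K n k l) ` ({..n} \<times> {..n})" by force
    then show "finite ?R" by (rule finite_subset) simp
    show "r \<le> K (n - 2) 0 (delta n) / K n 0 (delta n)" if "r \<in> ?R" for r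
      using that K_ratio_le[OF K_mono] by blast
    have "2 * 0 + delta n < n" "(2 * 0 + delta n) mod 2 = n mod 2"
      using n by (auto simp: delta_def mod2_eq_if)
    then show "K (n - 2) 0 (delta n) / K n 0 (delta n) \<in> ?R" by blast
  qed
next
  fix M assume "central_measure coupled_pascal M"
  then interpret coupled_central_measure M by (rule coupled_central_measureI)
  have return: "weight 2 (2, {}, {}) = 0"
    using K_ratio_le[OF K_mono] by (rule weight_return_eq_0)
  have off: "weight n (n, \<nu>, \<mu>) = 0"
    if lev: "(n, \<nu>, \<mu>) \<in> level coupled_pascal n" and ne: "2 * card \<nu> + card \<mu> \<noteq> n" for n \<nu> \<mu>
  proof -
    have "2 * card \<nu> + card \<mu> < n" and par: "(2 * card \<nu> + card \<mu>) mod 2 = n mod 2"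
      using lev ne by (simp_all add: mem_level_coupled_pascal)
    then have n: "n \<ge> 2" "2 * card \<nu> + card \<mu> \<le> n - 2"
      using same_parity_less[of "2 * card \<nu> + card \<mu>" n] by linarith+
    moreover have "(2 * card \<nu> + card \<mu>) mod 2 = (n - 2) mod 2"
      using par le_mod_geq[OF n(1)] by simp
    ultimately have "(n - 2, \<nu>, \<mu>) \<in> level coupled_pascal (n - 2)"
      using lev by (simp add: mem_level_coupled_pascal)
    from weight_off_coupled_eq_0[OF return this] show ?thesis
      by (simp only: le_add_diff_inverse2[OF n(1)])
  qed
  show "fully_supported_on M (in_pascalization coupled_young_graph)"
  proof (rule fully_supported_onI)
    fix n x assume x: "x \<in> level coupled_pascal n" "x \<notin> in_pascalization coupled_young_graph"
    from x(1) show "weight n x = 0"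
      by (rule level_coupled_pascalE)
        (use x off in \<open>auto simp: in_pascalization_def level_coupled_iff\<close>)
  qed
  have pairing: "weight 2 (2, {(0, 0)}, {}) = 0" using off by (rule weight_first_pairing_eq_0)
  show "fully_supported_on M young_in_pascalization"
  proof (rule fully_supported_onI)
    fix n x assume x: "x \<in> level coupled_pascal n" "x \<notin> young_in_pascalization"
    then obtain \<nu> \<mu> where y: "x = (n, \<nu>, \<mu>)" "young_diagram \<nu>" "young_diagram \<mu>"
      by (metis level_coupled_pascalE)
    show "weight n x = 0"
    proof (cases "2 * card \<nu> + card \<mu> = n")
      case True
      with x(2) y have "\<nu> \<noteq> {}"
        by (auto simp: young_in_pascalization_def young_graph_def diagrams_def)
      from weight_coupled_eq_0[OF pairing y(2,3) this True[symmetric]] show ?thesis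
        unfolding y(1) .
    next
      case False
      with off x y show ?thesis by simp
    qed
  qed
qed

end
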